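(* Let $\ell$ and $m$ be positive integers such that $2 \leq \ell < m$. Let $\mathcal{A} = (A_1, \ldots, A_m)$ be a sequence of finite subsets of $\mathbb{Z}_p$, where $p$ is prime and $|A_i| \geq 2$ for each $i \in [1, m]$. Let $A = A_1 \cup \cdots \cup A_m$, for $a\in A$ let $\mu(a) = \min\big(\ell, \sum_{j=1}^m \chi_{A_j}(a)\big)$ (where $\chi_{A_j}(a)=1$ if $a\in A_j$ and $0$ otherwise), and let $M = \{a \in A: \mu(a) = \ell\}$. Suppose \[ |\Sigma^{\ell}(\mathcal{A})| < \begin{cases} p - 1, & \text{if } \ell = 2; \\ p, & \text{if } \ell \geq 3. \end{cases} \] Then \[ |\Sigma^{\ell}(\mathcal{A})| = \sum_{a \in A} \mu (a) - \ell + 1 \] if and only if $\mathcal{A}$ is an $(\ell, d)$-minimizing sequence of sets for some $d$. Furthermore, if both the strict upper bound on $|\Sigma^{\ell}(\mathcal{A})|$ and this equality hold, then: (1) if $\ell = 2$, the sets $A_1 \cup M, \ldots, A_m \cup M$ are arithmetic progressions; (2) if $\ell \geq 3$, the sets $A, A_1 \cup M, \ldots, A_m \cup M$ are arithmetic progressions with the same common difference $d$; (3) if $\ell \geq 3$, the set $A$ is also an arithmetic progression with common difference $d$.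
   Context: $\mathbb{Z}_p$ is written additively. $\Sigma^{\ell}(\mathcal{A})$ is the set of all sums $a_{i_1} + \cdots + a_{i_{\ell}}$ with $a_{i_j} \in A_{i_j}$ and $1 \leq i_1 < \cdots < i_{\ell} \leq m$. The sequence $\mathcal{A}$ is an $(\ell, d)$-minimizing sequence of sets if there exist sets $B_1, \ldots, B_{\ell} \subseteq A$ such that: (i) $|B_i| \geq 2$ for all $i$; (ii) there is $d \neq 0$ such that each $B_i$ is an arithmetic progression with common difference $d$; (iii) $\mu(a) = \sum_{j=1}^{\ell} \chi_{B_j}(a)$ for every $a \in A$; (iv) $B_1 + \cdots + B_{\ell} = \Sigma^{\ell}(\mathcal{A})$. *)

theory Defs
  imports Main "HOL-Computational_Algebra.Primes"
begin

text \<open>Z_p is represented by the residues {0..<p} of type int, with addition mod p.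
  A sequence of sets A_1..A_m is a function As :: nat => int set on indices 1..m.\<close>

definition restricted_sumset :: "int \<Rightarrow> nat \<Rightarrow> nat \<Rightarrow> (nat \<Rightarrow> int set) \<Rightarrow> int set" where
  "restricted_sumset p l m As =
     {(\<Sum>i\<in>I. f i) mod p | I f. I \<subseteq> {1..m} \<and> card I = l \<and> (\<forall>i\<in>I. f i \<in> As i)}"

definition sumset :: "int \<Rightarrow> nat \<Rightarrow> (nat \<Rightarrow> int set) \<Rightarrow> int set" where
  "sumset p l Bs = {(\<Sum>j\<in>{1..l}. f j) mod p | f. \<forall>j\<in>{1..l}. f j \<in> Bs j}"

definition union_seq :: "nat \<Rightarrow> (nat \<Rightarrow> int set) \<Rightarrow> int set" where
  "union_seq m As = (\<Union>i\<in>{1..m}. As i)"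

definition mu :: "nat \<Rightarrow> nat \<Rightarrow> (nat \<Rightarrow> int set) \<Rightarrow> int \<Rightarrow> nat" where
  "mu l m As a = min l (card {j\<in>{1..m}. a \<in> As j})"

definition ap_diff :: "int \<Rightarrow> int \<Rightarrow> int set \<Rightarrow> bool" where
  "ap_diff p d B \<longleftrightarrow> (\<exists>a k. B = {(a + int i * d) mod p | i. i < k})"

definition is_ap :: "int \<Rightarrow> int set \<Rightarrow> bool" where
  "is_ap p B \<longleftrightarrow> (\<exists>d. d mod p \<noteq> 0 \<and> ap_diff p d B)"

definition minimizing :: "int \<Rightarrow> nat \<Rightarrow> int \<Rightarrow> nat \<Rightarrow> (nat \<Rightarrow> int set) \<Rightarrow> bool" where
  "minimizing p l d m As \<longleftrightarrow> d mod p \<noteq> 0 \<and>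
     (\<exists>Bs. (\<forall>j\<in>{1..l}. Bs j \<subseteq> union_seq m As \<and> card (Bs j) \<ge> 2 \<and> ap_diff p d (Bs j)) \<and>
           (\<forall>a\<in>union_seq m As. mu l m As a = card {j\<in>{1..l}. a \<in> Bs j}) \<and>
           sumset p l Bs = restricted_sumset p l m As)"

end

(*
Uncrossing two members A_i, A_j of a family, i.e. replacing them by their union and intersection,
keeps all multiplicities and creates no new sums of l members. Together with deleting members whose
elements have multiplicity above l, this reduces A_1, ..., A_m to l sets B_1, ..., B_l of size at
least 2 with multiplicities mu and B_1 + ... + B_l contained in the restricted sumset. By
Cauchy-Davenport and Vosper, equality forces all B_k to be progressions with one difference.

Applying the reduction to the members other than A_i, with l - 1 in place of l, yields such a family
having A_i Un M as one of its sets. For l >= 3, applying it to the members other than A_i and A_j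
yields two such families, one through A_i Un M and one through A_j Un M, with a further set in
common, so the differences agree. Finally A_i Un A_j Un M is a progression: either A_i Un M and
A_j Un M meet, or M is empty and A_i, A_j may be merged into a single member.
*)
theory Submission
  imports Defs "HOL-Library.Set_Algebras" "HOL-Number_Theory.Cong"
begin

section \<open>Uncrossing families of sets\<close>

text \<open>Uncrossing may leave an intersection with fewer than two elements, which cannot serve as
  a B_k. An empty one is dropped. A singleton {x} is dropped if x has multiplicity above l;
  otherwise l < m guarantees a third member that misses x and can absorb it. The threshold for the
  sumset comes from Vosper's theorem, which requires two residues outside a sum of two sets. For l
  >= 3 a further summand with two elements provides one of them, so it suffices that the whole
  sumset is not Z_p; for l = 2 both must be demanded, hence p - 1. Adding M to A_i is what keeps the
  capped multiplicities right when A_i is put back into a family reduced without it. Only the set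
  put back last is certain to be of this form, so A_i Un M and A_j Un M are compared through a third
  set. It exists as soon as l - 2 > 0; for l = 2 each A_i Un M keeps its own difference.\<close>

definition occurrences :: "'i set \<Rightarrow> ('i \<Rightarrow> 'a set) \<Rightarrow> 'a \<Rightarrow> nat" where
  "occurrences J A a = card {j\<in>J. a \<in> A j}"

text \<open>Partial choices (from \<open>I \<subseteq> K\<close>) are allowed so that refinement is transitive: a
  refinement turns a choice from all of \<open>K\<close> into a choice from only part of \<open>J\<close>.\<close>

definition refines :: "'i set \<Rightarrow> ('i \<Rightarrow> 'a set) \<Rightarrow> 'i set \<Rightarrow> ('i \<Rightarrow> 'a set) \<Rightarrow> bool" where
  "refines K B J A \<longleftrightarrow> (\<forall>I f. I \<subseteq> K \<and> (\<forall>k\<in>I. f k \<in> B k) \<longrightarrow>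
     (\<exists>\<sigma>. inj_on \<sigma> I \<and> \<sigma> ` I \<subseteq> J \<and> (\<forall>k\<in>I. f k \<in> A (\<sigma> k))))"

definition uncross :: "'i \<Rightarrow> 'i \<Rightarrow> ('i \<Rightarrow> 'a set) \<Rightarrow> 'i \<Rightarrow> 'a set" where
  "uncross i j A = A(i := A i \<union> A j, j := A i \<inter> A j)"

text \<open>\<open>K\<close> is taken inside \<open>J\<close>, so an index keeps its meaning when a
  family is reduced, and a reduced family can be said to pass through \<open>i\<close>. The capped
  multiplicities fix the total size of the sets \<open>B k\<close>; the refinement makes their sums
  sums of \<open>A\<close>.\<close>

definition realizes :: "nat \<Rightarrow> 'i set \<Rightarrow> ('i \<Rightarrow> 'a set) \<Rightarrow> 'i set \<Rightarrow> ('i \<Rightarrow> 'a set) \<Rightarrow> bool" where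
  "realizes l K B J A \<longleftrightarrow> K \<subseteq> J \<and> card K = l \<and> (\<forall>k\<in>K. 2 \<le> card (B k)) \<and>
     (\<forall>a. occurrences K B a = min l (occurrences J A a)) \<and> refines K B J A"

lemma occurrences_conv_sum: "finite J \<Longrightarrow> occurrences J A a = (\<Sum>j\<in>J. of_bool (a \<in> A j))"
  unfolding occurrences_def by (simp add: of_bool_def sum.If_cases Int_def)

lemma occurrences_remove:
  assumes "finite J" "j \<in> J"
  shows "occurrences J A a = of_bool (a \<in> A j) + occurrences (J - {j}) A a"
  unfolding occurrences_conv_sum[OF assms(1)] occurrences_conv_sum[OF finite_Diff[OF assms(1)]]
  by (rule sum.remove[OF assms])

lemma occurrences_cong: "(\<And>j. j \<in> J \<Longrightarrow> A j = B j) \<Longrightarrow> occurrences J A a = occurrences J B a"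
  unfolding occurrences_def by (metis (mono_tags, lifting))

lemma occurrences_pos:
  assumes "finite J" "j \<in> J" "a \<in> A j"
  shows "0 < occurrences J A a"
  using occurrences_remove[OF assms(1,2), of A a] assms(3) by simp

lemma occurrences_posD: "0 < occurrences J A a \<Longrightarrow> \<exists>j\<in>J. a \<in> A j"
  unfolding occurrences_def by (metis (mono_tags, lifting) Collect_empty_eq card.empty less_irrefl)

lemma refinesE:
  assumes "refines K B J A" "I \<subseteq> K" "\<And>k. k \<in> I \<Longrightarrow> f k \<in> B k"
  obtains \<sigma> where "inj_on \<sigma> I" "\<sigma> ` I \<subseteq> J" "\<And>k. k \<in> I \<Longrightarrow> f k \<in> A (\<sigma> k)"
proof -
  have "I \<subseteq> K \<and> (\<forall>k\<in>I. f k \<in> B k)" using assms(2,3) by blast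
  then have "\<exists>\<sigma>. inj_on \<sigma> I \<and> \<sigma> ` I \<subseteq> J \<and> (\<forall>k\<in>I. f k \<in> A (\<sigma> k))"
    using assms(1)[unfolded refines_def, THEN spec[of _ I], THEN spec[of _ f]] by (rule mp[rotated])
  then show thesis using that by blast
qed

lemma refines_trans:
  assumes "refines L C K B" "refines K B J A"
  shows "refines L C J A"
  unfolding refines_def
proof (intro allI impI, elim conjE)
  fix I f assume I: "I \<subseteq> L" and f: "\<forall>k\<in>I. f k \<in> C k"
  obtain \<sigma> where s: "inj_on \<sigma> I" "\<sigma> ` I \<subseteq> K" "\<And>k. k \<in> I \<Longrightarrow> f k \<in> B (\<sigma> k)"
    using refinesE[OF assms(1) I] f by metis
  have "\<And>k. k \<in> \<sigma> ` I \<Longrightarrow> f (inv_into I \<sigma> k) \<in> B k"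
    using s by auto
  then obtain \<tau> where t: "inj_on \<tau> (\<sigma> ` I)" "\<tau> ` \<sigma> ` I \<subseteq> J"
    "\<And>k. k \<in> \<sigma> ` I \<Longrightarrow> f (inv_into I \<sigma> k) \<in> A (\<tau> k)"
    using refinesE[OF assms(2) s(2), of "\<lambda>k. f (inv_into I \<sigma> k)"] by metis
  have "inj_on (\<tau> \<circ> \<sigma>) I" using s(1) t(1) by (rule comp_inj_on)
  moreover have "(\<tau> \<circ> \<sigma>) ` I \<subseteq> J" using t(2) by (simp add: image_comp)
  moreover have "\<forall>k\<in>I. f k \<in> A ((\<tau> \<circ> \<sigma>) k)" using t(3) s(1) by fastforce
  ultimately show "\<exists>\<sigma>. inj_on \<sigma> I \<and> \<sigma> ` I \<subseteq> J \<and> (\<forall>k\<in>I. f k \<in> A (\<sigma> k))" by blast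
qed

lemma refines_subset: "K \<subseteq> J \<Longrightarrow> refines K A J A"
  unfolding refines_def by (metis image_ident inj_on_id2 order_trans)

text \<open>A choice from the uncrossed family fails for \<open>A\<close> only when
  \<open>f i\<close> comes from \<open>A j\<close> alone. Exchanging \<open>i\<close> and
  \<open>j\<close> repairs it, since a value chosen at \<open>j\<close> lies in both sets.\<close>

lemma refines_uncross:
  assumes "i \<in> J" "j \<in> J" "i \<noteq> j"
  shows "refines J (uncross i j A) J A"
  unfolding refines_def
proof (intro allI impI, elim conjE)
  fix I f assume I: "I \<subseteq> J" and f: "\<forall>k\<in>I. f k \<in> uncross i j A k"
  show "\<exists>\<sigma>. inj_on \<sigma> I \<and> \<sigma> ` I \<subseteq> J \<and> (\<forall>k\<in>I. f k \<in> A (\<sigma> k))"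
  proof (cases "i \<in> I \<and> f i \<notin> A i")
    case True
    let ?s = "\<lambda>k. if k = i then j else if k = j then i else k"
    have "inj_on ?s I" by (auto simp: inj_on_def)
    moreover have "?s ` I \<subseteq> J" using I assms by auto
    moreover have "\<forall>k\<in>I. f k \<in> A (?s k)"
    proof
      fix k assume k: "k \<in> I"
      then have "f k \<in> uncross i j A k" "f i \<in> uncross i j A i" using f True by blast+
      then show "f k \<in> A (?s k)" using True assms(3) unfolding uncross_def by (auto split: if_splits)
    qed
    ultimately show ?thesis by blast
  next
    case False
    have "\<forall>k\<in>I. f k \<in> A k"
    proof
      fix k assume k: "k \<in> I"
      then have "f k \<in> uncross i j A k" using f by blast
      then show "f k \<in> A k" using False k unfolding uncross_def by (auto split: if_splits)
    qed
    then show ?thesis using I by (intro exI[of _ "\<lambda>k. k"]) auto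
  qed
qed

lemma occurrences_uncross:
  assumes "finite J" "i \<in> J" "j \<in> J" "i \<noteq> j"
  shows "occurrences J (uncross i j A) a = occurrences J A a"
proof -
  have i: "i \<in> J - {j}" using assms by blast
  have "occurrences (J - {j} - {i}) (uncross i j A) a = occurrences (J - {j} - {i}) A a"
    by (rule occurrences_cong) (auto simp: uncross_def)
  then have "occurrences J (uncross i j A) a
      = of_bool (a \<in> A i \<inter> A j) + (of_bool (a \<in> A i \<union> A j) + occurrences (J - {j} - {i}) A a)"
    using occurrences_remove[OF assms(1,3), of "uncross i j A" a] occurrences_remove[OF finite_Diff[OF assms(1)] i, of "uncross i j A" a]
      assms(4) by (simp add: uncross_def)
  then show ?thesis
    using occurrences_remove[OF assms(1,3), of A a] occurrences_remove[OF finite_Diff[OF assms(1)] i, of A a] by auto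
qed

lemma occurrences_delete:
  assumes "finite J" "j \<in> J" "\<And>a. a \<in> A j \<Longrightarrow> l < occurrences J A a"
  shows "min l (occurrences (J - {j}) A a) = min l (occurrences J A a)"
  using occurrences_remove[OF assms(1,2), of A a] assms(3)[of a] by (cases "a \<in> A j") auto

text \<open>The increasing quantity that stops the uncrossing. With \<open>v\<close> common and
  \<open>s\<close>, \<open>t\<close> private elements, the squares grow by 2 * s * t, which is
  positive as neither set contains the other.\<close>

lemma square_sum_uncross:
  assumes "finite J" "i \<in> J" "j \<in> J" "i \<noteq> j" "finite (A i)" "finite (A j)"
    "\<not> A i \<subseteq> A j" "\<not> A j \<subseteq> A i"
  shows "(\<Sum>k\<in>J. (card (A k))\<^sup>2) < (\<Sum>k\<in>J. (card (uncross i j A k))\<^sup>2)"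
proof -
  have i: "i \<in> J - {j}" using assms by blast
  have eq: "card (A i) + card (A j) = card (A i \<union> A j) + card (A i \<inter> A j)"
    using assms by (intro card_Un_Int)
  have "card (A i \<inter> A j) < card (A i)" "card (A i \<inter> A j) < card (A j)"
    using assms by (auto intro!: psubset_card_mono)
  then obtain s t where s: "card (A i) = card (A i \<inter> A j) + s" "0 < s"
    and t: "card (A j) = card (A i \<inter> A j) + t" "0 < t"
    by (metis less_imp_add_positive)
  define v where "v = card (A i \<inter> A j)"
  have u: "card (A i \<union> A j) = v + s + t" using eq s t v_def by simp
  have "(v + s)\<^sup>2 + (v + t)\<^sup>2 < (v + s + t)\<^sup>2 + v\<^sup>2"
    using s(2) t(2) by (simp add: power2_eq_square algebra_simps)
  then have "(card (A i))\<^sup>2 + (card (A j))\<^sup>2 < (card (A i \<union> A j))\<^sup>2 + (card (A i \<inter> A j))\<^sup>2"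
    unfolding u using s t v_def by simp
  moreover have "(\<Sum>k\<in>J-{j}-{i}. (card (uncross i j A k))\<^sup>2) = (\<Sum>k\<in>J-{j}-{i}. (card (A k))\<^sup>2)"
    by (rule sum.cong) (auto simp: uncross_def)
  ultimately show ?thesis
    using assms(1,4) i by (simp add: sum.remove[OF assms(1,3)] sum.remove[OF _ i] uncross_def)
qed

text \<open>A crossing pair with at least two common elements is uncrossed, and the induction
  continues with a larger sum of squares, which is bounded because all sets stay inside
  \<open>U\<close>. A pair with at most one common element allows an index to be removed at once. If
  neither kind of pair exists, the sets form a chain; the elements of the smallest one then occur
  \<open>card J > l\<close> times, and it can be deleted.\<close>

lemma shrink_family:
  assumes "finite J" "finite U" "l < card J" "\<And>i. i \<in> J \<Longrightarrow> A i \<subseteq> U \<and> 2 \<le> card (A i)"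
  shows "\<exists>j\<in>J. \<exists>A'. (\<forall>i\<in>J-{j}. A' i \<subseteq> U \<and> 2 \<le> card (A' i)) \<and>
     (\<forall>a. min l (occurrences (J-{j}) A' a) = min l (occurrences J A a)) \<and> refines (J-{j}) A' J A"
  using assms(4)
proof (induction "card J * (card U)\<^sup>2 - (\<Sum>k\<in>J. (card (A k))\<^sup>2)" arbitrary: A rule: less_induct)
  case less
  have fin: "finite (A i)" if "i \<in> J" for i
    using less.prems that assms(2) finite_subset by blast
  have union2: "2 \<le> card (A i \<union> A j)" "2 \<le> card (A j \<union> A i)" if "i \<in> J" "j \<in> J" for i j
    using less.prems[OF that(1)] fin that card_mono[of "A i \<union> A j" "A i"]
    by (auto simp: Un_commute)
  consider (cross) i j where "i \<in> J" "j \<in> J" "i \<noteq> j" "\<not> A i \<subseteq> A j" "\<not> A j \<subseteq> A i" "2 \<le> card (A i \<inter> A j)"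
    | (small) i j where "i \<in> J" "j \<in> J" "i \<noteq> j" "card (A i \<inter> A j) \<le> 1"
    | (chain) "\<forall>i\<in>J. \<forall>j\<in>J. A i \<subseteq> A j \<or> A j \<subseteq> A i"
    by (metis One_nat_def Suc_1 not_less_eq_eq order_refl)
  then show ?case
  proof cases
    case cross
    let ?A = "uncross i j A"
    have A': "?A k \<subseteq> U \<and> 2 \<le> card (?A k)" if "k \<in> J" for k
      using less.prems[OF that] less.prems[OF cross(1)] less.prems[OF cross(2)] cross union2
      unfolding uncross_def by auto
    have lt: "(\<Sum>k\<in>J. (card (A k))\<^sup>2) < (\<Sum>k\<in>J. (card (?A k))\<^sup>2)"
      using square_sum_uncross[of J i j A] cross fin assms by blast
    have "(\<Sum>k\<in>J. (card (?A k))\<^sup>2) \<le> (\<Sum>k\<in>J. (card U)\<^sup>2)"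
      using A' assms(2) by (intro sum_mono power_mono card_mono) auto
    then have "card J * (card U)\<^sup>2 - (\<Sum>k\<in>J. (card (?A k))\<^sup>2)
        < card J * (card U)\<^sup>2 - (\<Sum>k\<in>J. (card (A k))\<^sup>2)"
      using lt by simp
    from less.hyps[OF this A'] occurrences_uncross[OF assms(1) cross(1-3), of A]
    show ?thesis using refines_trans[OF _ refines_uncross[OF cross(1-3)]] by metis
  next
    case small
    let ?A = "uncross i j A"
    have card_out: "2 \<le> card (?A k) \<and> ?A k \<subseteq> U" if "k \<in> J - {j}" for k
      using less.prems[of k] less.prems[OF small(1)] less.prems[OF small(2)] that small union2
      unfolding uncross_def by auto
    show ?thesis
    proof (cases "\<forall>x\<in>A i \<inter> A j. l < occurrences J A x")
      case True
      then have "min l (occurrences (J - {j}) ?A a) = min l (occurrences J A a)" for a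
        using occurrences_delete[OF assms(1) small(2), of ?A l a] occurrences_uncross[OF assms(1) small(1-3), of A]
        by (simp add: uncross_def)
      moreover have "refines (J - {j}) ?A J A"
        by (rule refines_trans[OF refines_subset refines_uncross[OF small(1-3)]]) auto
      ultimately show ?thesis using card_out small(2) by blast
    next
      case False
      \<comment> \<open>Some \<open>A k\<close> misses the common point \<open>x\<close>, so \<open>x\<close> can be handed over to \<open>A k\<close>.\<close>
      then obtain x where x: "x \<in> A i \<inter> A j" "occurrences J A x \<le> l" by force
      have fij: "finite (A i \<inter> A j)" using fin small by blast
      have Aij: "A i \<inter> A j = {x}"
        using small(4) x(1) fij card_le_Suc0_iff_eq[of "A i \<inter> A j"] by auto
      have "{k\<in>J. x \<in> A k} \<noteq> J" using x(2) assms(3) unfolding occurrences_def by auto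
      then obtain k where k: "k \<in> J" "x \<notin> A k" by blast
      have ne: "k \<noteq> i" "k \<noteq> j" using k x by auto
      let ?B = "uncross k j ?A"
      have Bj: "?B j = {}" using ne Aij k unfolding uncross_def by auto
      have "min l (occurrences (J - {j}) ?B a) = min l (occurrences J A a)" for a
        using occurrences_delete[OF assms(1) small(2), of ?B l a] Bj
          occurrences_uncross[OF assms(1) small(1-3), of A] occurrences_uncross[OF assms(1) k(1) small(2) ne(2), of ?A]
        by simp
      moreover have "refines (J - {j}) ?B J A"
        by (rule refines_trans[OF refines_subset refines_trans[OF refines_uncross[OF k(1) small(2) ne(2)]
                refines_uncross[OF small(1-3)]]]) auto
      moreover have "?B n \<subseteq> U \<and> 2 \<le> card (?B n)" if n: "n \<in> J - {j}" for n
      proof (cases "n = k")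
        case True
        have "?B n = insert x (A k)" using True ne Aij unfolding uncross_def by auto
        then show ?thesis using less.prems[OF k(1)] fin[OF k(1)] x less.prems[OF small(1)] k(2) by auto
      next
        case False
        then have "?B n = ?A n" using n unfolding uncross_def by auto
        then show ?thesis using card_out[OF n] by simp
      qed
      ultimately show ?thesis using small(2) by blast
    qed
  next
    case chain
    have "J \<noteq> {}" using assms(3) by auto
    then obtain j where j: "j \<in> J" "\<forall>i\<in>J. card (A j) \<le> card (A i)"
      using assms(1) ex_is_arg_min_if_finite[of J "\<lambda>i. card (A i)"]
      unfolding is_arg_min_linorder by blast
    have sub: "A j \<subseteq> A i" if "i \<in> J" for i
      using chain j that fin by (metis card_seteq subset_refl)
    have "l < occurrences J A a" if "a \<in> A j" for a
    proof -
      have "{i\<in>J. a \<in> A i} = J" using sub that by auto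
      then show ?thesis using assms(3) unfolding occurrences_def by simp
    qed
    then have "min l (occurrences (J - {j}) A a) = min l (occurrences J A a)" for a
      by (rule occurrences_delete[OF assms(1) j(1)])
    moreover have "refines (J - {j}) A J A" by (rule refines_subset) auto
    ultimately show ?thesis using j(1) less.prems by (metis DiffD1)
  qed
qed

lemma realizes_ex:
  assumes "finite J" "l \<le> card J" "\<And>i. i \<in> J \<Longrightarrow> 2 \<le> card (A i)"
  shows "\<exists>K B. realizes l K B J A"
  using assms
proof (induction "card J" arbitrary: J A rule: less_induct)
  case less
  show ?case
  proof (cases "l = card J")
    case True
    have "occurrences J A a \<le> card J" for a
      unfolding occurrences_def using less.prems(1) by (simp add: card_mono)
    then have "realizes l J A J A"
      unfolding realizes_def using True less.prems(3) refines_subset[of J J A] by simp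
    then show ?thesis by blast
  next
    case False
    have "finite (\<Union>i\<in>J. A i)"
    proof (rule finite_UN_I[OF less.prems(1)])
      fix i assume "i \<in> J"
      then have "0 < card (A i)" using less.prems(3)[of i] by simp
      then show "finite (A i)" by (rule card_ge_0_finite)
    qed
    moreover have "A i \<subseteq> (\<Union>i\<in>J. A i) \<and> 2 \<le> card (A i)" if "i \<in> J" for i
      using that less.prems(3) by blast
    ultimately obtain j A' where j: "j \<in> J" and A': "\<forall>i\<in>J-{j}. 2 \<le> card (A' i)"
      "\<And>a. min l (occurrences (J-{j}) A' a) = min l (occurrences J A a)" "refines (J-{j}) A' J A"
      using shrink_family[of J "\<Union>i\<in>J. A i" l A] less.prems(1,2) False
      by (metis le_neq_implies_less)
    have "\<exists>K B. realizes l K B (J - {j}) A'"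
      using less.prems j A' False by (intro less.hyps) (auto simp: card_gt_0_iff)
    then show ?thesis unfolding realizes_def using A' refines_trans by (metis Diff_subset order_trans)
  qed
qed

text \<open>The saturated elements compensate for the smaller cap: one that lies outside
  \<open>A i\<close> is counted \<open>l\<close> times by \<open>B\<close> and once more in the new
  set. For the refinement, a value of the new set outside \<open>A i\<close> lies in at least
  \<open>l + 1\<close> members of \<open>A\<close>, while the other chosen values occupy at most
  \<open>l\<close> of them, so a free member can supply it.\<close>

lemma realizes_insert:
  assumes "finite J" "i \<in> J" "2 \<le> card (A i)" "finite (A i \<union> {a. Suc l \<le> occurrences J A a})"
    and R: "realizes l K B (J - {i}) A"
  shows "realizes (Suc l) (insert i K) (B(i := A i \<union> {a. Suc l \<le> occurrences J A a})) J A"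
proof -
  let ?M = "{a. Suc l \<le> occurrences J A a}"
  let ?B = "B(i := A i \<union> ?M)"
  have K: "K \<subseteq> J - {i}" "card K = l" "\<And>k. k \<in> K \<Longrightarrow> 2 \<le> card (B k)"
    "\<And>a. occurrences K B a = min l (occurrences (J - {i}) A a)" "refines K B (J - {i}) A"
    using R unfolding realizes_def by auto
  have finK: "finite K" and iK: "i \<notin> K" using K(1) assms(1) finite_subset by auto
  have "2 \<le> card (A i \<union> ?M)"
    using assms(3,4) by (meson Un_upper1 card_mono order_trans)
  moreover have "occurrences (insert i K) ?B a = min (Suc l) (occurrences J A a)" for a
  proof -
    have "occurrences K ?B a = occurrences K B a" using iK by (intro occurrences_cong) auto
    then have "occurrences (insert i K) ?B a = of_bool (a \<in> A i \<or> Suc l \<le> occurrences J A a) + occurrences K B a"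
      using occurrences_remove[of "insert i K" i ?B a] finK iK by simp
    then show ?thesis using K(4)[of a] occurrences_remove[OF assms(1,2), of A a]
      by (cases "a \<in> A i"; cases "Suc l \<le> occurrences J A a") simp_all
  qed
  moreover have "refines (insert i K) ?B J A"
    unfolding refines_def
  proof (intro allI impI, elim conjE)
    fix I f assume I: "I \<subseteq> insert i K" and f: "\<forall>k\<in>I. f k \<in> ?B k"
    have I': "I - {i} \<subseteq> K" using I by blast
    have "f k \<in> B k" if "k \<in> I - {i}" for k proof -
      have "k \<in> I" "k \<noteq> i" using that by auto
      then show ?thesis using f by (metis fun_upd_other)
    qed
    then obtain \<sigma> where s: "inj_on \<sigma> (I - {i})" "\<sigma> ` (I - {i}) \<subseteq> J - {i}"
      "\<And>k. k \<in> I - {i} \<Longrightarrow> f k \<in> A (\<sigma> k)"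
      using refinesE[OF K(5) I'] by metis
    show "\<exists>\<sigma>. inj_on \<sigma> I \<and> \<sigma> ` I \<subseteq> J \<and> (\<forall>k\<in>I. f k \<in> A (\<sigma> k))"
    proof (cases "i \<in> I")
      case False
      then show ?thesis using s by (intro exI[of _ \<sigma>]) auto
    next
      case True
      have "\<exists>j\<in>J. f i \<in> A j \<and> j \<notin> \<sigma> ` (I - {i})"
      proof (cases "f i \<in> A i")
        case True
        then show ?thesis using s(2) assms(2) by blast
      next
        case False
        then have "Suc l \<le> card {j\<in>J. f i \<in> A j}"
          using f True unfolding occurrences_def by auto
        moreover have "card (\<sigma> ` (I - {i})) \<le> l"
          using card_image_le[of "I - {i}" \<sigma>] card_mono[OF finK I'] finite_subset[OF I' finK] K(2)
          by linarith
        ultimately have "\<not> {j\<in>J. f i \<in> A j} \<subseteq> \<sigma> ` (I - {i})"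
          using card_mono[of "\<sigma> ` (I - {i})"] finite_subset[OF I' finK]
          by (meson finite_imageI not_less_eq_eq order_trans)
        then show ?thesis by blast
      qed
      then obtain j where j: "j \<in> J" "f i \<in> A j" "j \<notin> \<sigma> ` (I - {i})" by blast
      let ?s = "\<sigma>(i := j)"
      have "inj_on ?s (I - {i})" using s(1) by (subst inj_on_cong[of _ _ \<sigma>]) auto
      moreover have "?s ` (I - {i}) = \<sigma> ` (I - {i})" by (rule image_cong) auto
      ultimately have "inj_on ?s (insert i (I - {i}))" using j(3)
        unfolding inj_on_insert by (simp del: fun_upd_apply add: fun_upd_same)
      then have "inj_on ?s I" by (rule inj_on_subset) blast
      moreover have "?s ` I \<subseteq> J" using s(2) j(1) by auto
      moreover have "\<forall>k\<in>I. f k \<in> A (?s k)" using s(3) j(2) by auto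
      ultimately show ?thesis by blast
    qed
  qed
  moreover have "2 \<le> card (?B k)" if "k \<in> insert i K" for k
    using that K(3) calculation(1) by (cases "k = i") auto
  moreover have "insert i K \<subseteq> J" "card (insert i K) = Suc l"
    using K(1,2) finK iK assms(2) by auto
  ultimately show ?thesis unfolding realizes_def by blast
qed

lemma sum_occurrences:
  assumes "finite U" "finite K" "\<And>k. k \<in> K \<Longrightarrow> B k \<subseteq> U"
  shows "(\<Sum>a\<in>U. occurrences K B a) = (\<Sum>k\<in>K. card (B k))"
proof -
  have "(\<Sum>a\<in>U. occurrences K B a) = (\<Sum>a\<in>U. \<Sum>k\<in>K. of_bool (a \<in> B k))"
    using assms(2) by (simp add: occurrences_conv_sum del: sum_of_bool_eq)
  also have "\<dots> = (\<Sum>k\<in>K. \<Sum>a\<in>U. of_bool (a \<in> B k))" by (rule sum.swap)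
  also have "\<dots> = (\<Sum>k\<in>K. card (B k))"
  proof (rule sum.cong)
    fix k assume "k \<in> K"
    then have "U \<inter> {a. a \<in> B k} = B k" using assms(3) by auto
    then show "(\<Sum>a\<in>U. of_bool (a \<in> B k)) = card (B k)" using assms(1) by simp
  qed simp
  finally show ?thesis .
qed

lemma realizes_subset:
  assumes "realizes l K B J A" "finite J" "k \<in> K"
  shows "B k \<subseteq> (\<Union>j\<in>J. A j)"
proof
  fix a assume a: "a \<in> B k"
  have "finite K" using assms unfolding realizes_def by (meson finite_subset)
  then have "0 < occurrences K B a" using occurrences_pos[of K k a B] assms(3) a by blast
  moreover have "occurrences K B a = min l (occurrences J A a)" using assms(1) unfolding realizes_def by blast
  ultimately have "0 < occurrences J A a" by simp
  from occurrences_posD[OF this] show "a \<in> (\<Union>j\<in>J. A j)" by blast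
qed

section \<open>Sumsets of residue classes\<close>

locale prime_modulus =
  fixes p :: int
  assumes prime: "prime p"
begin

text \<open>A subset of \<open>\<int>/p\<close> is handled as a union of residue classes in \<open>int\<close>, so that sumsets,
  translates and complements are those of \<open>int\<close> and only cardinalities refer to \<open>p\<close>.\<close>

definition periodic :: "int set \<Rightarrow> bool" where
  "periodic X \<longleftrightarrow> (\<forall>x y. x mod p = y mod p \<longrightarrow> x \<in> X \<longrightarrow> y \<in> X)"

definition rcard :: "int set \<Rightarrow> nat" where
  "rcard X = card (X \<inter> {0..<p})"

definition shift :: "int \<Rightarrow> int set \<Rightarrow> int set" where
  "shift t X = {x. x - t \<in> X}"

text \<open>A progression is left at only one point by adding its difference. The empty set and \<open>UNIV\<close>
  count as arcs, and the number of exits also makes sense when \<open>p dvd d\<close>.\<close>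

definition arc :: "int \<Rightarrow> int set \<Rightarrow> bool" where
  "arc d X \<longleftrightarrow> rcard {x\<in>X. x + d \<notin> X} \<le> 1"

lemma p_pos: "p > 0" using prime prime_gt_0_int by blast

lemma periodicD: "periodic X \<Longrightarrow> x \<in> X \<Longrightarrow> x mod p = y mod p \<Longrightarrow> y \<in> X"
  unfolding periodic_def by blast

lemma periodic_mod: "periodic X \<Longrightarrow> x mod p \<in> X \<longleftrightarrow> x \<in> X"
  unfolding periodic_def by (metis mod_mod_trivial)

lemma periodicI: "(\<And>x y. p dvd x - y \<Longrightarrow> x \<in> X \<Longrightarrow> y \<in> X) \<Longrightarrow> periodic X"
  unfolding periodic_def by (metis mod_eq_dvd_iff)

lemma periodic_dvd: "periodic X \<Longrightarrow> p dvd x - y \<Longrightarrow> x \<in> X \<longleftrightarrow> y \<in> X"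
  unfolding periodic_def by (metis mod_eq_dvd_iff)

lemma periodic_trivial [simp]: "periodic {}" "periodic UNIV"
  unfolding periodic_def by simp_all

lemma periodic_Un [intro]: "periodic X \<Longrightarrow> periodic Y \<Longrightarrow> periodic (X \<union> Y)"
  unfolding periodic_def by blast

lemma periodic_Int [intro]: "periodic X \<Longrightarrow> periodic Y \<Longrightarrow> periodic (X \<inter> Y)"
  unfolding periodic_def by blast

lemma periodic_Compl [intro]: "periodic X \<Longrightarrow> periodic (- X)"
  unfolding periodic_def by (metis ComplD ComplI)

lemma periodic_shift [intro]: "periodic X \<Longrightarrow> periodic (shift t X)"
  unfolding periodic_def shift_def by (metis mem_Collect_eq mod_diff_left_eq)

lemma periodic_uminus [intro]: "periodic X \<Longrightarrow> periodic {x. - x \<in> X}"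
  unfolding periodic_def by (metis mem_Collect_eq mod_minus_cong)

lemma periodic_plus [intro]:
  assumes "periodic X"
  shows "periodic (X + Y)"
proof (rule periodicI)
  fix z w assume zw: "p dvd z - w" and "z \<in> X + Y"
  then obtain x y where xy: "z = x + y" "x \<in> X" "y \<in> Y" by (auto elim: set_plus_elim)
  have "w - y \<in> X" using periodic_dvd[OF assms, of x "w - y"] xy zw by (simp add: algebra_simps)
  then have "(w - y) + y \<in> X + Y" using xy by (intro set_plus_intro)
  then show "w \<in> X + Y" by simp
qed

lemma periodic_exit [intro]: "periodic X \<Longrightarrow> periodic {x\<in>X. x + d \<notin> X}"
  unfolding periodic_def by (metis (no_types, lifting) mem_Collect_eq mod_add_cong)

lemma rcard_mono: "X \<subseteq> Y \<Longrightarrow> rcard X \<le> rcard Y"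
  unfolding rcard_def by (intro card_mono) auto

lemma rcard_le: "rcard X \<le> nat p"
  unfolding rcard_def using card_mono[of "{0..<p}" "X \<inter> {0..<p}"] by simp

lemma rcard_Un_Int: "rcard (X \<union> Y) + rcard (X \<inter> Y) = rcard X + rcard Y"
proof -
  have "(X \<union> Y) \<inter> {0..<p} = X \<inter> {0..<p} \<union> Y \<inter> {0..<p}"
    "X \<inter> Y \<inter> {0..<p} = (X \<inter> {0..<p}) \<inter> (Y \<inter> {0..<p})" by auto
  then show ?thesis unfolding rcard_def using card_Un_Int[of "X \<inter> {0..<p}" "Y \<inter> {0..<p}"] by simp
qed

lemma rcard_UNIV: "rcard UNIV = nat p"
  unfolding rcard_def by simp

lemma rcard_empty: "rcard {} = 0"
  unfolding rcard_def by simp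

lemma rcard_Compl: "rcard X + rcard (- X) = nat p"
  using rcard_Un_Int[of X "- X"] by (simp add: rcard_UNIV rcard_empty)

lemma rcard_diff: "Y \<subseteq> X \<Longrightarrow> rcard Y + rcard (X - Y) = rcard X"
  using rcard_Un_Int[of Y "X - Y"] by (simp add: rcard_empty Un_absorb1)

lemma periodic_subset_eq:
  assumes "periodic X" "periodic Y" "X \<subseteq> Y" "rcard Y \<le> rcard X"
  shows "X = Y"
proof -
  have "X \<inter> {0..<p} = Y \<inter> {0..<p}"
    using assms(3,4) unfolding rcard_def by (intro card_seteq) auto
  moreover have "y mod p \<in> {0..<p}" for y using p_pos by simp
  ultimately show ?thesis using periodic_mod[OF assms(1)] periodic_mod[OF assms(2)] by blast
qed

lemma rcard_pos: "periodic X \<Longrightarrow> x \<in> X \<Longrightarrow> 0 < rcard X"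
  using periodic_subset_eq[of "{}" X] by (cases "rcard X") auto

lemma rcard_eq_p: "periodic X \<Longrightarrow> nat p \<le> rcard X \<Longrightarrow> X = UNIV"
  using periodic_subset_eq[of X UNIV] rcard_UNIV by simp

lemma rcard_less_p: "periodic X \<Longrightarrow> X \<noteq> UNIV \<Longrightarrow> rcard X < nat p"
  using rcard_eq_p by fastforce

lemma rcard_le_1_iff:
  assumes "periodic X"
  shows "rcard X \<le> 1 \<longleftrightarrow> (\<forall>x\<in>X. \<forall>y\<in>X. p dvd x - y)"
proof
  assume "rcard X \<le> 1"
  then have eq: "\<And>x y. x \<in> X \<inter> {0..<p} \<Longrightarrow> y \<in> X \<inter> {0..<p} \<Longrightarrow> x = y"
    unfolding rcard_def by (metis One_nat_def card_le_Suc0_iff_eq finite_Int finite_atLeastLessThan_int)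
  show "\<forall>x\<in>X. \<forall>y\<in>X. p dvd x - y"
  proof (intro ballI)
    fix x y assume "x \<in> X" "y \<in> X"
    then have "x mod p \<in> X \<inter> {0..<p}" "y mod p \<in> X \<inter> {0..<p}"
      using periodic_mod[OF assms] p_pos by auto
    then show "p dvd x - y" using eq mod_eq_dvd_iff by blast
  qed
next
  assume r: "\<forall>x\<in>X. \<forall>y\<in>X. p dvd x - y"
  have "x = y" if "x \<in> X \<inter> {0..<p}" "y \<in> X \<inter> {0..<p}" for x y
    using r that by (metis IntD1 IntD2 atLeastLessThan_iff mod_eq_dvd_iff mod_pos_pos_trivial)
  then show "rcard X \<le> 1" unfolding rcard_def
    by (metis One_nat_def card_le_Suc0_iff_eq finite_Int finite_atLeastLessThan_int)
qed

lemma rcard_ge_2: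
  assumes "periodic X" "2 \<le> rcard X"
  obtains x y where "x \<in> X" "y \<in> X" "\<not> p dvd x - y"
  using rcard_le_1_iff[OF assms(1)] assms(2) by auto

lemma rcard_bij:
  assumes "periodic X" "periodic Y" "\<And>x. x \<in> X \<longleftrightarrow> f x \<in> Y" "\<And>x y. p dvd x - y \<Longrightarrow> p dvd f x - f y"
    "\<And>x. p dvd f (g x) - x" "\<And>x. p dvd g (f x) - x" "\<And>x y. p dvd x - y \<Longrightarrow> p dvd g x - g y"
  shows "rcard X = rcard Y"
proof -
  have m: "x mod p \<in> {0..<p}" for x using p_pos by simp
  have e: "x = y" if "p dvd x - y" "x \<in> {0..<p}" "y \<in> {0..<p}" for x y
    using that by (metis atLeastLessThan_iff mod_eq_dvd_iff mod_pos_pos_trivial)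
  have d: "p dvd x mod p - x" "p dvd x - x mod p" for x
    by (metis mod_eq_dvd_iff mod_mod_trivial)+
  have gf: "p dvd g (f x mod p) - x" for x
    using dvd_add[OF assms(7)[OF d(1)[of "f x"]] assms(6)[of x]] by simp
  have fg: "p dvd f (g x mod p) - x" for x
    using dvd_add[OF assms(4)[OF d(1)[of "g x"]] assms(5)[of x]] by simp
  have "bij_betw (\<lambda>x. f x mod p) (X \<inter> {0..<p}) (Y \<inter> {0..<p})"
  proof (rule bij_betw_byWitness[where f' = "\<lambda>x. g x mod p"])
    show "\<forall>a\<in>X \<inter> {0..<p}. g (f a mod p) mod p = a"
      proof
      fix a assume a: "a \<in> X \<inter> {0..<p}"
      show "g (f a mod p) mod p = a"
        using e[of "g (f a mod p) mod p" a] m[of "g (f a mod p)"] a dvd_add[OF d(1)[of "g (f a mod p)"] gf[of a]] by simp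
    qed
    show "\<forall>a\<in>Y \<inter> {0..<p}. f (g a mod p) mod p = a"
      proof
      fix a assume a: "a \<in> Y \<inter> {0..<p}"
      show "f (g a mod p) mod p = a"
        using e[of "f (g a mod p) mod p" a] m[of "f (g a mod p)"] a dvd_add[OF d(1)[of "f (g a mod p)"] fg[of a]] by simp
    qed
    show "(\<lambda>x. f x mod p) ` (X \<inter> {0..<p}) \<subseteq> Y \<inter> {0..<p}"
      using assms(3) periodic_mod[OF assms(2)] m by auto
    show "(\<lambda>x. g x mod p) ` (Y \<inter> {0..<p}) \<subseteq> X \<inter> {0..<p}"
      using assms(3) periodic_mod[OF assms(1)] periodic_dvd[OF assms(2) assms(5)] m by auto
  qed
  then show ?thesis unfolding rcard_def by (rule bij_betw_same_card)
qed

lemma rcard_shift [simp]: "periodic X \<Longrightarrow> rcard (shift t X) = rcard X"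
  by (rule rcard_bij[where f = "\<lambda>x. x - t" and g = "\<lambda>x. x + t"]) (auto simp: shift_def periodic_shift[unfolded shift_def])

lemma rcard_uminus: "periodic X \<Longrightarrow> rcard {x. - x \<in> X} = rcard X"
  by (rule rcard_bij[where f = uminus and g = uminus]) (auto simp: periodic_uminus dvd_diff_commute)

text \<open>Modulo a prime, \<open>t\<close> is invertible, so repeated steps by \<open>t\<close>
  from one element reach every class.\<close>

lemma invariant_UNIV:
  assumes "periodic X" "x \<in> X" "\<not> p dvd t" "\<And>x. x \<in> X \<Longrightarrow> x + t \<in> X"
  shows "X = UNIV"
proof -
  have step: "x + int n * t \<in> X" for n
  proof (induction n)
    case (Suc n)
    show ?case using assms(4)[OF Suc.IH] by (simp add: algebra_simps)
  qed (use assms(2) in simp)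
  have "coprime t p" using prime assms(3) by (metis coprime_commute prime_imp_coprime)
  then obtain s where s: "[t * s = 1] (mod p)" using cong_solve_coprime_int by blast
  show ?thesis
  proof -
    have "y \<in> X" for y
    proof -
    \<comment> \<open>With \<open>s\<close> inverse to \<open>t\<close>, this is the number of steps
      from \<open>x\<close> to \<open>y\<close>, reduced mod \<open>p\<close> to be
      nonnegative.\<close>
    let ?n = "nat ((s * (y - x)) mod p)"
    have "[int ?n = s * (y - x)] (mod p)" using p_pos by (simp add: cong_def)
    then have "[int ?n * t = s * (y - x) * t] (mod p)" by (rule cong_scalar_right)
    also have "s * (y - x) * t = t * s * (y - x)" by simp
    also have "[t * s * (y - x) = 1 * (y - x)] (mod p)" using s by (rule cong_scalar_right)
    finally have "[x + int ?n * t = x + 1 * (y - x)] (mod p)" by (rule cong_add[OF cong_refl])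
    then have "(x + int ?n * t) mod p = y mod p" by (simp add: cong_def)
    then show "y \<in> X" using periodicD[OF assms(1) step] by blast
    qed
    then show ?thesis by blast
  qed
qed

section \<open>The Dyson transform and the Cauchy-Davenport inequality\<close>

lemma dyson_transform:
  assumes "periodic A" "periodic B"
  shows "rcard (A \<union> shift e B) + rcard (B \<inter> shift (- e) A) = rcard A + rcard B"
    and "(A \<union> shift e B) + (B \<inter> shift (- e) A) \<subseteq> A + B"
proof -
  \<comment> \<open>The second set of the transform is a translate of the intersection, so the sizes
    balance by inclusion-exclusion.\<close>
  have "shift e (B \<inter> shift (- e) A) = A \<inter> shift e B" unfolding shift_def by auto
  then have "rcard (B \<inter> shift (- e) A) = rcard (A \<inter> shift e B)"
    using rcard_shift[of "B \<inter> shift (- e) A" e] assms by (metis periodic_Int periodic_shift)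
  then show "rcard (A \<union> shift e B) + rcard (B \<inter> shift (- e) A) = rcard A + rcard B"
    using rcard_Un_Int[of A "shift e B"] assms by simp
  show "(A \<union> shift e B) + (B \<inter> shift (- e) A) \<subseteq> A + B"
  proof
    fix z assume "z \<in> (A \<union> shift e B) + (B \<inter> shift (- e) A)"
    then obtain x y where z: "z = x + y" and x: "x \<in> A \<or> x - e \<in> B" and y: "y \<in> B" "y + e \<in> A"
      unfolding shift_def by (auto elim!: set_plus_elim)
    from x show "z \<in> A + B"
    proof
      assume "x \<in> A" then show ?thesis using y z by (auto intro: set_plus_intro)
    next
      assume "x - e \<in> B"
      then have "(y + e) + (x - e) \<in> A + B" using y by (intro set_plus_intro)
      then show ?thesis using z by (simp add: algebra_simps)
    qed
  qed
qed

lemma UNIV_plus: "Y \<noteq> {} \<Longrightarrow> (UNIV :: int set) + Y = UNIV"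
  by (auto simp: set_plus_def) (metis diff_add_cancel)

text \<open>Induction on the size of \<open>B\<close> by Dyson transforms. If some difference
  \<open>b' - b\<close> moves an element \<open>a\<close> of \<open>A\<close> out of
  \<open>A\<close>, the transform with \<open>a - b\<close> keeps \<open>b\<close> and loses
  \<open>b'\<close>, so \<open>B\<close> becomes smaller but not empty. Otherwise \<open>B\<close>
  is a single class or \<open>A\<close> is everything.\<close>

lemma cauchy_davenport:
  assumes "periodic A" "periodic B" "A \<noteq> {}" "B \<noteq> {}"
  shows "A + B = UNIV \<or> rcard A + rcard B \<le> rcard (A + B) + 1"
  using assms
proof (induction "rcard B" arbitrary: A B rule: less_induct)
  case less
  show ?case
  proof (cases "\<forall>a\<in>A. \<forall>b\<in>B. \<forall>b'\<in>B. a - b + b' \<in> A")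
    case True
    show ?thesis
    proof (cases "rcard B \<le> 1")
      case True
      obtain b where b: "b \<in> B" using less.prems by blast
      have "shift b A \<subseteq> A + B"
      proof
        fix x assume "x \<in> shift b A"
        then have "(x - b) + b \<in> A + B" using b unfolding shift_def by (intro set_plus_intro) auto
        then show "x \<in> A + B" by simp
      qed
      then show ?thesis using rcard_mono[of "shift b A" "A + B"] True less.prems by simp
    next
      case False
      then obtain b b' where "b \<in> B" "b' \<in> B" "\<not> p dvd b' - b"
        using rcard_le_1_iff[OF less.prems(2)] by auto
      moreover obtain a where "a \<in> A" using less.prems by blast
      ultimately have "A = UNIV"
        using True invariant_UNIV[OF less.prems(1), of a "b' - b"]
        by (smt (verit, ccfv_threshold))
      then show ?thesis using UNIV_plus less.prems by blast
    qed
  next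
    case False
    then obtain a b b' where ab: "a \<in> A" "b \<in> B" "b' \<in> B" "a - b + b' \<notin> A" by blast
    let ?A = "A \<union> shift (a - b) B" and ?B = "B \<inter> shift (- (a - b)) A"
    have b: "b \<in> ?B" "b' \<notin> ?B" using ab unfolding shift_def by (auto simp: algebra_simps)
    have periodic: "periodic ?A" "periodic ?B" using less.prems by auto
    have "rcard ?B < rcard B"
      using periodic_subset_eq[OF periodic(2) less.prems(2)] ab(3) b(2) by (metis Int_lower1 not_le_imp_less)
    then have "?A + ?B = UNIV \<or> rcard ?A + rcard ?B \<le> rcard (?A + ?B) + 1"
      using less.hyps[of ?B ?A] periodic b(1) ab(1) by blast
    moreover note dyson_transform[OF less.prems(1,2), of "a - b"]
    ultimately show ?thesis using rcard_mono[of "?A + ?B" "A + B"] by auto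
  qed
qed

section \<open>Arcs: closure properties, critical pairs, Vosper's theorem\<close>

lemma arc_exit_unique:
  assumes "periodic X" "arc d X" "x \<in> X" "x + d \<notin> X" "y \<in> X" "y + d \<notin> X"
  shows "p dvd x - y"
  using assms rcard_le_1_iff[OF periodic_exit[OF assms(1)], of d] unfolding arc_def by blast

text \<open>The exits, moved on by \<open>d\<close>, are exactly what the translate by
  \<open>d\<close> adds to \<open>X\<close>. In this form the arc property is an upper bound on a
  size, which Cauchy-Davenport can supply.\<close>

lemma arc_iff_Un:
  assumes "periodic X"
  shows "arc d X \<longleftrightarrow> rcard (X \<union> shift d X) \<le> rcard X + 1"
proof -
  have "shift d {x\<in>X. x + d \<notin> X} = (X \<union> shift d X) - X" unfolding shift_def by auto
  then have "rcard {x\<in>X. x + d \<notin> X} = rcard ((X \<union> shift d X) - X)"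
    using rcard_shift[OF periodic_exit[OF assms], of d d] by simp
  then show ?thesis using rcard_diff[of X "X \<union> shift d X"] unfolding arc_def by auto
qed

lemma arc_minus:
  assumes "periodic X"
  shows "arc (- d) X \<longleftrightarrow> arc d X"
proof -
  have "shift d (X \<union> shift (- d) X) = X \<union> shift d X" unfolding shift_def by auto
  then show ?thesis
    using rcard_shift[OF periodic_Un[OF assms periodic_shift[OF assms]], of d "- d"] assms by (simp add: arc_iff_Un)
qed

lemma arc_Compl:
  assumes "periodic X" "arc d X"
  shows "arc d (- X)"
proof -
  have "{x \<in> - X. x + - d \<notin> - X} = shift d {x\<in>X. x + d \<notin> X}" unfolding shift_def by auto
  then have "arc (- d) (- X)" using assms rcard_shift[OF periodic_exit[OF assms(1)], of d d] unfolding arc_def by simp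
  then show ?thesis using arc_minus[of "- X"] assms by auto
qed

lemma arc_uminus:
  assumes "periodic X" "arc d {x. - x \<in> X}"
  shows "arc d X"
proof -
  have "{x. - x \<in> {x \<in> X. x + (- d) \<notin> X}} = {x \<in> {x. - x \<in> X}. x + d \<notin> {x. - x \<in> X}}"
    by (auto simp: algebra_simps)
  then have "arc (- d) X" using assms rcard_uminus[OF periodic_exit[OF assms(1), of "- d"]] unfolding arc_def by simp
  then show ?thesis using arc_minus assms(1) by blast
qed

text \<open>An exit of the sum splits only into an exit of \<open>X\<close> and an exit of
  \<open>Y\<close>, since otherwise one summand could be moved on by \<open>d\<close>; both exits
  are unique modulo \<open>p\<close>.\<close>

lemma arc_plus:
  assumes "periodic X" "periodic Y" "arc d X" "arc d Y"
  shows "arc d (X + Y)"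
proof -
  have "p dvd z - w" if z: "z \<in> X + Y" "z + d \<notin> X + Y" and w: "w \<in> X + Y" "w + d \<notin> X + Y" for z w
  proof -
    have ex: "\<exists>x y. u = x + y \<and> x \<in> X \<and> y \<in> Y \<and> x + d \<notin> X \<and> y + d \<notin> Y"
      if u: "u \<in> X + Y" "u + d \<notin> X + Y" for u
    proof -
      obtain x y where xy: "u = x + y" "x \<in> X" "y \<in> Y" using u(1) unfolding set_plus_def by blast
      have "x + d \<notin> X" using u(2) xy set_plus_intro[of "x + d" X y Y] by (auto simp: algebra_simps)
      moreover have "y + d \<notin> Y" using u(2) xy set_plus_intro[of x X "y + d" Y] by (auto simp: algebra_simps)
      ultimately show ?thesis using xy by blast
    qed
    obtain x y where x: "z = x + y" "x \<in> X" "y \<in> Y" "x + d \<notin> X" "y + d \<notin> Y" using ex[OF z] by blast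
    obtain x' y' where x': "w = x' + y'" "x' \<in> X" "y' \<in> Y" "x' + d \<notin> X" "y' + d \<notin> Y" using ex[OF w] by blast
    have "p dvd x - x'" "p dvd y - y'"
      using arc_exit_unique assms x x' by blast+
    then have "p dvd (x - x') + (y - y')" by (rule dvd_add)
    then show ?thesis using x(1) x'(1) by (simp add: algebra_simps)
  qed
  then show ?thesis unfolding arc_def using rcard_le_1_iff[of "{x \<in> X + Y. x + d \<notin> X + Y}"] assms
    by blast
qed

lemma arc_transfer:
  assumes "periodic X" "periodic Y" "arc d X" "2 \<le> rcard X" "Y \<noteq> {}"
    and tight: "rcard (X + Y) + 1 \<le> rcard X + rcard Y" and ne: "X + Y \<noteq> UNIV"
  shows "arc d Y"
proof -
  \<comment> \<open>Shortening \<open>X\<close> by one term and replacing \<open>Y\<close> by \<open>Y + {0, d}\<close> does not enlarge the sumset.\<close>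
  let ?X = "X - {x\<in>X. x + d \<notin> X}" and ?Y = "Y \<union> shift d Y"
  have NX: "rcard X \<le> rcard ?X + 1"
    using rcard_diff[of "{x\<in>X. x + d \<notin> X}" X] assms(3) unfolding arc_def by auto
  have periodic: "periodic ?X" "periodic ?Y" using assms periodic_exit[OF assms(1), of d] by (auto simp: Diff_eq)
  have "?X \<noteq> {}" using NX assms(4) rcard_empty by (metis add_0 not_less_eq_eq numeral_2_eq_2 One_nat_def le_trans)
  have sub: "?X + ?Y \<subseteq> X + Y"
  proof
    fix z assume "z \<in> ?X + ?Y"
    then obtain x y where z: "z = x + y" "x \<in> X" "x + d \<in> X" and y: "y \<in> Y \<or> y - d \<in> Y"
      unfolding shift_def by (auto elim!: set_plus_elim)
    from y show "z \<in> X + Y"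
    proof
      assume "y \<in> Y" then show ?thesis using z by (auto intro: set_plus_intro)
    next
      assume "y - d \<in> Y"
      then have "(x + d) + (y - d) \<in> X + Y" using z by (intro set_plus_intro)
      then show ?thesis using z by simp
    qed
  qed
  \<comment> \<open>The shortened set is nonempty because \<open>X\<close> has two classes. The
    bound yields |X| - 1 + |Y Un (Y + d)| \<le> |X + Y| + 1 \<le> |X| + |Y|, which is the arc
    property of \<open>Y\<close>.\<close>
  then have "rcard ?X + rcard ?Y \<le> rcard (?X + ?Y) + 1"
    using cauchy_davenport[OF periodic \<open>?X \<noteq> {}\<close>] assms(5) ne by blast
  then show ?thesis using rcard_mono[OF sub] NX tight arc_iff_Un[OF assms(2)] by simp
qed

lemma arc_summands:
  assumes "periodic A" "periodic B" "2 \<le> rcard A" "2 \<le> rcard B"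
    and tight: "rcard (A + B) + 1 \<le> rcard A + rcard B" and ne: "rcard (A + B) + 2 \<le> nat p" and arc: "arc d (A + B)"
  shows "arc d A \<and> arc d B"
proof -
  \<comment> \<open>The complement of \<open>A + B\<close> and \<open>- B\<close> form again a critical pair.\<close>
  let ?D = "- (A + B)" and ?B = "{x. - x \<in> B}"
  have nonempty: "A \<noteq> {}" "B \<noteq> {}" using assms(3,4) rcard_empty by auto
  \<comment> \<open>The bound \<open>ne\<close> provides two classes in the complement, as the
    transfer has to start from an arc with at least two classes.\<close>
  have D: "periodic ?D" "arc d ?D" "2 \<le> rcard ?D"
    using assms arc_Compl rcard_Compl[of "A + B"] by auto
  have sub: "?D + ?B \<subseteq> - A"
  proof
    fix z assume "z \<in> ?D + ?B"
    then obtain x y where "z = x + y" "x \<notin> A + B" "- y \<in> B" by (auto elim!: set_plus_elim)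
    then show "z \<in> - A" using set_plus_intro[of z A "- y" B] by auto
  qed
  have "rcard (?D + ?B) + 1 \<le> rcard ?D + rcard ?B"
    using rcard_mono[OF sub] rcard_Compl[of A] rcard_Compl[of "A + B"] rcard_uminus[OF assms(2)] tight by simp
  moreover have "?D + ?B \<noteq> UNIV" using sub nonempty by blast
  moreover have "?B \<noteq> {}" using rcard_uminus[OF assms(2)] rcard_empty assms(4)
    by (metis not_numeral_le_zero)
  ultimately have "arc d ?B"
    using arc_transfer[OF D(1) periodic_uminus[OF assms(2)] D(2,3)] by blast
  then have B: "arc d B" using arc_uminus assms(2) by blast
  have "B + A \<noteq> UNIV" using ne rcard_UNIV by (auto simp: add.commute)
  then have "arc d A"
    using arc_transfer[OF assms(2,1) B assms(4) nonempty(1)] tight by (simp add: add.commute)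
  then show ?thesis using B by blast
qed

text \<open>Induction on the size of \<open>B\<close>. If a Dyson transform shrinks \<open>B\<close>
  but leaves two classes, the transformed pair is critical with the same sum \<open>A + B\<close>;
  that sum is then an arc, and \<open>arc_summands\<close> pulls the property back to
  \<open>A\<close> and \<open>B\<close>. If no transform based at \<open>b0\<close> does so, the
  difference is read off from \<open>B\<close> directly.\<close>

lemma vosper:
  assumes "periodic A" "periodic B" "2 \<le> rcard A" "2 \<le> rcard B"
    and "rcard (A + B) + 1 \<le> rcard A + rcard B" and "rcard (A + B) + 2 \<le> nat p"
  shows "\<exists>d. \<not> p dvd d \<and> arc d A \<and> arc d B"
  using assms
proof (induction "rcard B" arbitrary: A B rule: less_induct)
  case less
  note pA = less.prems(1) and pB = less.prems(2)
  have neAB: "A + B \<noteq> UNIV" using less.prems(6) rcard_UNIV by auto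
  have nonempty: "A \<noteq> {}" "B \<noteq> {}" using less.prems(3,4) rcard_empty by auto
  obtain b0 b1 where b: "b0 \<in> B" "b1 \<in> B" "\<not> p dvd b1 - b0"
    using rcard_ge_2[OF pB less.prems(4)] by metis
  show ?case
  proof (cases "\<exists>a\<in>A. 2 \<le> rcard (B \<inter> shift (- (a - b0)) A) \<and> rcard (B \<inter> shift (- (a - b0)) A) < rcard B")
    case True
    then obtain a where a: "a \<in> A" "2 \<le> rcard (B \<inter> shift (- (a - b0)) A)" "rcard (B \<inter> shift (- (a - b0)) A) < rcard B"
      by blast
    let ?A = "A \<union> shift (a - b0) B" and ?B = "B \<inter> shift (- (a - b0)) A"
    note t = dyson_transform[OF pA pB, of "a - b0"]
    have periodic: "periodic ?A" "periodic ?B" using pA pB by auto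
    have NA: "2 \<le> rcard ?A" using less.prems(3) rcard_mono[of A ?A] by auto
    have le: "rcard (?A + ?B) \<le> rcard (A + B)" by (rule rcard_mono[OF t(2)])
    obtain d where d: "\<not> p dvd d" "arc d ?A" "arc d ?B"
      using less.hyps[OF a(3) periodic NA a(2)] le less.prems(5,6) t(1) by auto
    have "?A \<noteq> {}" "?B \<noteq> {}" using NA a(2) rcard_empty by auto
    then have "rcard ?A + rcard ?B \<le> rcard (?A + ?B) + 1"
      using cauchy_davenport[OF periodic] t(2) neAB by blast
    \<comment> \<open>Cauchy-Davenport gives the smaller sum at least as many classes as tightness
      allows for \<open>A + B\<close>.\<close>
    then have "?A + ?B = A + B"
      using t less.prems(5) periodic pA by (intro periodic_subset_eq) auto
    then have "arc d (A + B)" using arc_plus[OF periodic d(2,3)] by simp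
    then show ?thesis using arc_summands[OF less.prems(1-6)] d(1) by blast
  next
    case False
    \<comment> \<open>Now \<open>a + (B - b0)\<close> lies in \<open>A\<close> or meets it only in \<open>a\<close>; \<open>F\<close> collects the \<open>a\<close> of the
      second kind. All translates \<open>a + C\<close> with \<open>a \<in> F\<close> fill the same set \<open>G\<close>, hence \<open>F\<close> is a single class.\<close>
    define F where "F = {a\<in>A. \<exists>b\<in>B. a - b0 + b \<notin> A}"
    define C where "C = shift (- b0) B - {x. p dvd x}"
    define G where "G = shift (- b0) (A + B) - A"
    have per0: "periodic {x. p dvd x}" by (rule periodicI) (auto simp: dvd_diff_right_iff)
    have N0: "rcard {x. p dvd x} \<le> 1" using rcard_le_1_iff[OF per0] by simp
    have pC: "periodic C" unfolding C_def Diff_eq using pB per0 by blast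
    have pG: "periodic G" unfolding G_def Diff_eq using pA by blast
    have NC: "rcard B \<le> rcard C + 1"
    proof -
      have "{x. p dvd x} \<subseteq> shift (- b0) B"
      proof
        fix x assume "x \<in> {x. p dvd x}"
        then show "x \<in> shift (- b0) B" using b(1) periodic_dvd[OF pB, of "x + b0" b0] unfolding shift_def by simp
      qed
      then show ?thesis using rcard_diff[of "{x. p dvd x}" "shift (- b0) B"] N0 pB unfolding C_def by simp
    qed
    have "A \<subseteq> shift (- b0) (A + B)" using b(1) unfolding shift_def by (auto intro: set_plus_intro)
    \<comment> \<open>By tightness the translate of \<open>A + B\<close> has at most |B| - 1 classes
      outside \<open>A\<close>, and \<open>C\<close> has at least that many.\<close>
    then have NG: "rcard G \<le> rcard C"
      using rcard_diff[of A "shift (- b0) (A + B)"] less.prems(5) pA NC unfolding G_def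
      by (simp add: periodic_plus)
    have shC: "shift a C = G" if a: "a \<in> F" for a
    proof -
      let ?B = "B \<inter> shift (- (a - b0)) A"
      have aA: "a \<in> A" using a F_def by blast
      obtain b where bb: "b \<in> B" "a - b0 + b \<notin> A" using a F_def by blast
      have pB': "periodic ?B" using pA pB by blast
      have b0: "b0 \<in> ?B" using b(1) aA unfolding shift_def by simp
      have "b \<notin> ?B" using bb unfolding shift_def by (simp add: algebra_simps)
      then have "rcard ?B < rcard B"
        using periodic_subset_eq[OF pB' pB] bb(1) by (metis Int_lower1 not_le_imp_less)
      then have "rcard ?B \<le> 1" using False aA by fastforce
      then have out: "p dvd x - b0" if "x \<in> ?B" for x
        using rcard_le_1_iff[OF pB'] that b0 by blast
      have "shift a C \<subseteq> G"
      proof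
        fix x assume "x \<in> shift a C"
        then have x: "x - a + b0 \<in> B" "\<not> p dvd x - a" unfolding C_def shift_def by auto
        have "a + (x - a + b0) \<in> A + B" using aA x(1) by (rule set_plus_intro)
        moreover have "x \<notin> A" using out[of "x - a + b0"] x unfolding shift_def by auto
        ultimately show "x \<in> G" unfolding G_def shift_def by (simp add: algebra_simps)
      qed
      then show ?thesis using pC pG NG by (intro periodic_subset_eq) auto
    qed
    obtain c where c: "c \<in> C" using b unfolding C_def shift_def by (metis DiffI add_diff_cancel_left' diff_minus_eq_add mem_Collect_eq diff_add_cancel)
    have c': "\<not> p dvd c" "c + b0 \<in> B" using c unfolding C_def shift_def by auto
    have "p dvd a' - a" if a: "a \<in> F" "a' \<in> F" for a a'
    proof (rule ccontr)
      assume n: "\<not> p dvd a' - a"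
      \<comment> \<open>Equal translates make \<open>C\<close> invariant under
        \<open>a' - a\<close>, hence everything, although \<open>C\<close> omits the class of
        0.\<close>
      have "shift a C = shift a' C" using shC a by simp
      then have "x + (a' - a) \<in> C" if "x \<in> C" for x
        using that unfolding shift_def set_eq_iff mem_Collect_eq
        by (metis add_diff_cancel_right' diff_add_eq add_diff_eq)
      then have "C = UNIV" using invariant_UNIV[OF pC c n] by blast
      then show False unfolding C_def by auto
    qed
    then have F1: "p dvd a - a'" if "a \<in> F" "a' \<in> F" for a a' using that by blast
    \<comment> \<open>Any difference \<open>c\<close> between \<open>b0\<close> and another class of
      \<open>B\<close> serves: a point of \<open>A\<close> that leaves \<open>A\<close> under
      \<open>c\<close> belongs to \<open>F\<close>.\<close>
    have "{x\<in>A. x + c \<notin> A} \<subseteq> F" using c'(2) unfolding F_def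
      by (auto intro!: bexI[of _ "c + b0"])
    then have "arc c A" unfolding arc_def using rcard_le_1_iff[OF periodic_exit[OF pA]] F1 by blast
    moreover from this have "arc c B"
      using arc_transfer[OF pA pB _ less.prems(3) nonempty(2) less.prems(5) neAB] by blast
    ultimately show ?thesis using c'(1) by blast
  qed
qed

section \<open>Arcs as progressions\<close>

definition progression :: "int \<Rightarrow> int \<Rightarrow> nat \<Rightarrow> int set" where
  "progression a d k = {x. \<exists>i<k. p dvd x - (a + int i * d)}"

lemma periodic_progression [intro]: "periodic (progression a d k)"
proof (rule periodicI)
  fix x y assume xy: "p dvd x - y" and "x \<in> progression a d k"
  then obtain i where i: "i < k" "p dvd x - (a + int i * d)" unfolding progression_def by blast
  have "p dvd (x - (a + int i * d)) - (x - y)" using i(2) xy by (rule dvd_diff)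
  then have "p dvd y - (a + int i * d)" by (simp add: algebra_simps)
  then show "y \<in> progression a d k" unfolding progression_def using i(1) by blast
qed

lemma progression_Int_range: "progression a d k \<inter> {0..<p} = (\<lambda>i. (a + int i * d) mod p) ` {..<k}"
proof
  show "progression a d k \<inter> {0..<p} \<subseteq> (\<lambda>i. (a + int i * d) mod p) ` {..<k}"
  proof
    fix x assume x: "x \<in> progression a d k \<inter> {0..<p}"
    then obtain i where i: "i < k" "p dvd x - (a + int i * d)" unfolding progression_def by blast
    then have "x mod p = (a + int i * d) mod p" by (simp add: mod_eq_dvd_iff)
    then have "x = (a + int i * d) mod p" using x by simp
    then show "x \<in> (\<lambda>i. (a + int i * d) mod p) ` {..<k}" using i(1) by blast
  qed
  show "(\<lambda>i. (a + int i * d) mod p) ` {..<k} \<subseteq> progression a d k \<inter> {0..<p}"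
  proof
    fix x assume "x \<in> (\<lambda>i. (a + int i * d) mod p) ` {..<k}"
    then obtain i where i: "i < k" "x = (a + int i * d) mod p" by blast
    then have "x mod p = (a + int i * d) mod p" by simp
    then have "p dvd x - (a + int i * d)" by (simp only: mod_eq_dvd_iff)
    then show "x \<in> progression a d k \<inter> {0..<p}" using i p_pos unfolding progression_def by auto
  qed
qed

lemma rcard_progression_le: "rcard (progression a d k) \<le> k"
  unfolding rcard_def progression_Int_range using card_image_le[of "{..<k}"] by simp

lemma rcard_progression:
  assumes "\<not> p dvd d" "k \<le> nat p"
  shows "rcard (progression a d k) = k"
proof -
  have "inj_on (\<lambda>i. (a + int i * d) mod p) {..<k}"
  proof (rule inj_onI)
    fix i j assume ij: "i \<in> {..<k}" "j \<in> {..<k}" "(a + int i * d) mod p = (a + int j * d) mod p"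
    then have "p dvd (a + int i * d) - (a + int j * d)" by (simp only: mod_eq_dvd_iff)
    then have "p dvd (int i - int j) * d" by (simp add: algebra_simps)
    then have "p dvd int i - int j" using assms(1) prime prime_dvd_mult_iff by blast
    then have "int i mod p = int j mod p" by (simp only: mod_eq_dvd_iff)
    moreover have "int i < p" "int j < p" using ij(1,2) assms(2) p_pos by auto
    ultimately show "i = j" by simp
  qed
  then show ?thesis unfolding rcard_def progression_Int_range by (simp add: card_image)
qed

lemma progression_exit:
  assumes "x \<in> progression a d k" "x + d \<notin> progression a d k"
  shows "0 < k" "p dvd x - (a + int (k - 1) * d)"
proof -
  obtain i where i: "i < k" "p dvd x - (a + int i * d)" using assms(1) unfolding progression_def by blast
  have "p dvd (x + d) - (a + int (Suc i) * d)" using i(2) by (simp add: algebra_simps)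
  then have "\<not> Suc i < k" using assms(2) unfolding progression_def by blast
  then have "i = k - 1" using i(1) by simp
  then show "0 < k" "p dvd x - (a + int (k - 1) * d)" using i by auto
qed

lemma arc_progression: "arc d (progression a d k)"
proof -
  have "p dvd x - y" if "x \<in> progression a d k" "x + d \<notin> progression a d k" "y \<in> progression a d k" "y + d \<notin> progression a d k" for x y
    using dvd_diff[OF progression_exit(2)[OF that(1,2)] progression_exit(2)[OF that(3,4)]] by simp
  then show ?thesis unfolding arc_def using rcard_le_1_iff[OF periodic_exit[OF periodic_progression], of a d k d] by blast
qed

text \<open>The progression starts at a point entered from outside, which exists unless
  \<open>X\<close> is everything. If it left \<open>X\<close> after fewer than
  \<open>rcard X\<close> terms, the only exit would be used up; the rest of \<open>X\<close> would
  be closed under adding \<open>d\<close> while missing \<open>a\<close>, hence empty, against the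
  count.\<close>

lemma arc_is_progression:
  assumes "periodic X" "arc d X" "X \<noteq> {}" "\<not> p dvd d"
  shows "\<exists>a. X = progression a d (rcard X)"
proof (cases "X = UNIV")
  case True
  then show ?thesis
    using periodic_subset_eq[of "progression 0 d (rcard X)" X] rcard_progression[OF assms(4), of "rcard X" 0] rcard_le[of X] assms(1) by auto
next
  case False
  have nd: "\<not> p dvd - d" using assms(4) by simp
  obtain x where "x \<in> X" using assms(3) by blast
  then obtain a where a: "a \<in> X" "a + - d \<notin> X"
    using invariant_UNIV[OF assms(1) _ nd] False by blast
  have "progression a d n \<subseteq> X" if "n \<le> rcard X" for n
    using that
  proof (induction n)
    case 0
    then show ?case unfolding progression_def by auto
  next
    case (Suc n)
    then have sub: "progression a d n \<subseteq> X" by simp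
    have "a + int n * d \<in> X"
    proof (rule ccontr)
      assume n: "a + int n * d \<notin> X"
      then have n0: "n \<noteq> 0" using a(1) by (cases n) auto
      have ain: "a \<in> progression a d n" using n0 unfolding progression_def by (auto intro!: exI[of _ 0])
      define e where "e = a + int (n - 1) * d"
      have e: "e \<in> progression a d n" using n0 unfolding progression_def e_def by (auto intro!: exI[of _ "n - 1"])
      have "e + d = a + int n * d" using n0 unfolding e_def
        by (cases n) (auto simp: algebra_simps)
      then have eX: "e \<in> X" "e + d \<notin> X" using e sub n by auto
      have perY: "periodic (X - progression a d n)" unfolding Diff_eq using assms(1) by blast
      have inv: "y + d \<in> X - progression a d n" if y: "y \<in> X - progression a d n" for y
      proof -
        have "y + d \<in> X"
        proof (rule ccontr)
          assume "y + d \<notin> X"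
          then have "p dvd y - e" using arc_exit_unique[OF assms(1,2) _ _ eX] y by blast
          then show False using periodic_dvd[OF periodic_progression] e y by blast
        qed
        moreover have "y + d \<notin> progression a d n"
        proof
          assume "y + d \<in> progression a d n"
          then obtain i where i: "i < n" "p dvd (y + d) - (a + int i * d)" unfolding progression_def by blast
          show False
          proof (cases i)
            case 0
            then have "p dvd y - (a + - d)" using i(2) by (simp add: algebra_simps)
            then show False using periodic_dvd[OF assms(1)] y a(2) by blast
          next
            case (Suc i')
            then have "p dvd y - (a + int i' * d)" using i(2) by (simp add: algebra_simps)
            then show False using y i(1) Suc unfolding progression_def by auto
          qed
        qed
        ultimately show ?thesis by blast
      qed
      have "X - progression a d n = {}"
        using invariant_UNIV[OF perY _ assms(4) inv] ain by blast
      then have "rcard X \<le> n" using rcard_progression_le[of a d n] rcard_mono[of X "progression a d n"] by auto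
      then show False using Suc.prems by simp
    qed
    then have new: "x \<in> X" if "p dvd x - (a + int n * d)" for x
      using periodic_dvd[OF assms(1) that] by simp
    show ?case
    proof
      fix x assume "x \<in> progression a d (Suc n)"
      then obtain i where i: "i < Suc n" "p dvd x - (a + int i * d)" unfolding progression_def by blast
      have "x \<in> progression a d n" if "i \<noteq> n"
      proof -
        have "i < n" using i(1) that by simp
        then show ?thesis using i(2) unfolding progression_def by blast
      qed
      then show "x \<in> X" using new i(2) sub by (cases "i = n") auto
    qed
  qed
  then have "progression a d (rcard X) = X"
    using periodic_subset_eq[OF periodic_progression assms(1)] rcard_progression[OF assms(4) rcard_le[of X]] by simp
  then show ?thesis by metis
qed

lemma rcard_plus_arcs:
  assumes "periodic X" "arc d X" "X \<noteq> {}" "periodic Y" "arc d Y" "Y \<noteq> {}" "\<not> p dvd d"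
  shows "rcard (X + Y) + 1 \<le> rcard X + rcard Y"
proof -
  obtain a k where a: "X = progression a d k" "k = rcard X" using arc_is_progression[OF assms(1-3,7)] by blast
  obtain b l where b: "Y = progression b d l" "l = rcard Y" using arc_is_progression[OF assms(4-7)] by blast
  have pos: "0 < rcard X" "0 < rcard Y" using rcard_pos assms by blast+
  have "X + Y \<subseteq> progression (a + b) d (k + l - 1)"
  proof
    fix z assume "z \<in> X + Y"
    then obtain x y where z: "z = x + y" "x \<in> X" "y \<in> Y" by (auto elim: set_plus_elim)
    obtain i where i: "i < k" "p dvd x - (a + int i * d)" using z(2) a(1) unfolding progression_def by blast
    obtain j where j: "j < l" "p dvd y - (b + int j * d)" using z(3) b(1) unfolding progression_def by blast
    have "p dvd (x - (a + int i * d)) + (y - (b + int j * d))" using i(2) j(2) by (rule dvd_add)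
    then have "p dvd z - (a + b + int (i + j) * d)" using z(1) by (simp add: algebra_simps)
    moreover have "i + j < k + l - 1" using i(1) j(1) by simp
    ultimately show "z \<in> progression (a + b) d (k + l - 1)" unfolding progression_def by blast
  qed
  from rcard_mono[OF this] have "rcard (X + Y) \<le> k + l - 1" using rcard_progression_le[of "a + b" d "k + l - 1"] by linarith
  then show ?thesis using pos a(2) b(2) by simp
qed

text \<open>From the common point \<open>z\<close> the two progressions run together, with
  \<open>s\<close> and \<open>t\<close> steps left. The one that ends first stays inside the other
  and yields no exit of the union; so two exits force \<open>s = t\<close> and agree modulo
  \<open>p\<close>.\<close>

lemma progression_Un_exits:
  assumes "z \<in> progression a d k" "z \<in> progression b d l"
    and x: "x \<in> progression a d k" "x + d \<notin> progression a d k" "x + d \<notin> progression b d l"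
    and y: "y \<in> progression b d l" "y + d \<notin> progression b d l" "y + d \<notin> progression a d k"
  shows "p dvd x - y"
proof -
  obtain i where i: "i < k" "p dvd z - (a + int i * d)" using assms(1) unfolding progression_def by blast
  obtain j where j: "j < l" "p dvd z - (b + int j * d)" using assms(2) unfolding progression_def by blast
  define s t where "s = k - 1 - i" and "t = l - 1 - j"
  have k: "int (k - 1) = int i + int s" "int (l - 1) = int j + int t"
    using i(1) j(1) unfolding s_def t_def by auto
  have xs: "p dvd x - (z + int s * d)"
    using dvd_diff[OF progression_exit(2)[OF x(1,2)] i(2)] unfolding k by (simp add: algebra_simps)
  have yt: "p dvd y - (z + int t * d)"
    using dvd_diff[OF progression_exit(2)[OF y(1,2)] j(2)] unfolding k by (simp add: algebra_simps)
  have "\<not> s < t"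
  proof
    assume "s < t"
    have "p dvd (x + d) - (b + int (j + Suc s) * d)"
      using dvd_add[OF xs j(2)] by (simp add: algebra_simps)
    moreover from \<open>s < t\<close> have "j + Suc s < l" unfolding t_def by simp
    ultimately show False using x(3) unfolding progression_def by blast
  qed
  moreover have "\<not> t < s"
  proof
    assume "t < s"
    have "p dvd (y + d) - (a + int (i + Suc t) * d)"
      using dvd_add[OF yt i(2)] by (simp add: algebra_simps)
    moreover from \<open>t < s\<close> have "i + Suc t < k" unfolding s_def by simp
    ultimately show False using y(3) unfolding progression_def by blast
  qed
  ultimately have "s = t" by simp
  then show ?thesis using dvd_diff[OF xs yt] by (simp add: algebra_simps)
qed

lemma arc_Un:
  assumes "periodic X" "arc d X" "periodic Y" "arc d Y" "\<not> p dvd d" "X \<inter> Y \<noteq> {}"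
  shows "arc d (X \<union> Y)"
proof -
  obtain z where z: "z \<in> X" "z \<in> Y" using assms(6) by blast
  have "X \<noteq> {}" "Y \<noteq> {}" using z by auto
  then obtain a k b l where ab: "X = progression a d k" "Y = progression b d l"
    using arc_is_progression[OF assms(1,2) _ assms(5)] arc_is_progression[OF assms(3,4) _ assms(5)] by blast
  have XY: "p dvd x - y" if "x \<in> X" "x + d \<notin> X \<union> Y" "y \<in> Y" "y + d \<notin> X \<union> Y" for x y
    using progression_Un_exits[of z a d k b l x y] that z ab by auto
  have YX: "p dvd x - y" if "x \<in> Y" "x + d \<notin> X \<union> Y" "y \<in> X" "y + d \<notin> X \<union> Y" for x y
    using XY[OF that(3,4,1,2)] dvd_diff_commute by blast
  have "p dvd x - y"
    if xy: "x \<in> X \<union> Y" "x + d \<notin> X \<union> Y" "y \<in> X \<union> Y" "y + d \<notin> X \<union> Y" for x y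
  proof -
    consider "x \<in> X" "y \<in> X" | "x \<in> Y" "y \<in> Y" | "x \<in> X" "y \<in> Y" | "x \<in> Y" "y \<in> X" using xy by blast
    then show ?thesis
    proof cases
      case 1 then show ?thesis using arc_exit_unique[OF assms(1,2)] xy by blast
    next
      case 2 then show ?thesis using arc_exit_unique[OF assms(3,4)] xy by blast
    next
      case 3 then show ?thesis using XY xy by blast
    next
      case 4 then show ?thesis using YX xy by blast
    qed
  qed
  then show ?thesis unfolding arc_def using rcard_le_1_iff[OF periodic_exit[OF periodic_Un[OF assms(1,3)]], of d] by blast
qed

section \<open>Sums of families\<close>

text \<open>Membership is up to a multiple of \<open>p\<close>, so the set is periodic even for
  empty \<open>K\<close>, where it is the class of 0 and not a single integer.\<close>

definition family_sum :: "'i set \<Rightarrow> ('i \<Rightarrow> int set) \<Rightarrow> int set" where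
  "family_sum K X = {x. \<exists>f. (\<forall>k\<in>K. f k \<in> X k) \<and> p dvd x - sum f K}"

text \<open>Equality in the iterated Cauchy-Davenport bound. One inequality is recorded; the other
  follows because the sum is not everything.\<close>

definition tight :: "'i set \<Rightarrow> ('i \<Rightarrow> int set) \<Rightarrow> bool" where
  "tight K X \<longleftrightarrow> finite K \<and> (\<forall>k\<in>K. periodic (X k) \<and> 2 \<le> rcard (X k)) \<and> family_sum K X \<noteq> UNIV \<and>
     rcard (family_sum K X) + card K \<le> (\<Sum>k\<in>K. rcard (X k)) + 1"

lemma periodic_family_sum [intro]: "periodic (family_sum K X)"
proof (rule periodicI)
  fix x y assume xy: "p dvd x - y" and "x \<in> family_sum K X"
  then obtain f where f: "\<forall>k\<in>K. f k \<in> X k" "p dvd x - sum f K" unfolding family_sum_def by blast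
  have "p dvd (x - sum f K) - (x - y)" using f(2) xy by (rule dvd_diff)
  then show "y \<in> family_sum K X" unfolding family_sum_def using f(1) by auto
qed

lemma family_sum_empty: "family_sum {} X = {x. p dvd x}"
  unfolding family_sum_def by simp

lemma family_sum_insert:
  assumes "finite K" "k \<notin> K"
  shows "family_sum (insert k K) X = X k + family_sum K X"
proof
  show "family_sum (insert k K) X \<subseteq> X k + family_sum K X"
  proof
    fix x assume "x \<in> family_sum (insert k K) X"
    then obtain f where f: "\<forall>k\<in>insert k K. f k \<in> X k" "p dvd x - sum f (insert k K)"
      unfolding family_sum_def by blast
    have "x - f k \<in> family_sum K X" using f assms unfolding family_sum_def by (auto simp: algebra_simps)
    then have "f k + (x - f k) \<in> X k + family_sum K X" using f(1) by (intro set_plus_intro) auto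
    then show "x \<in> X k + family_sum K X" by simp
  qed
  show "X k + family_sum K X \<subseteq> family_sum (insert k K) X"
  proof
    fix x assume "x \<in> X k + family_sum K X"
    then obtain a y where x: "x = a + y" "a \<in> X k" "y \<in> family_sum K X" by (auto elim: set_plus_elim)
    then obtain f where f: "\<forall>k\<in>K. f k \<in> X k" "p dvd y - sum f K" unfolding family_sum_def by blast
    let ?f = "f(k := a)"
    have "sum ?f K = sum f K" using assms(2) by (intro sum.cong) auto
    then have "p dvd x - sum ?f (insert k K)" using f(2) assms x(1) by simp
    moreover have "\<forall>j\<in>insert k K. ?f j \<in> X j" using f(1) x(2) by auto
    ultimately show "x \<in> family_sum (insert k K) X" unfolding family_sum_def by blast
  qed
qed

lemma family_sum_nonempty: "(\<And>k. k \<in> K \<Longrightarrow> X k \<noteq> {}) \<Longrightarrow> family_sum K X \<noteq> {}"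
proof -
  assume "\<And>k. k \<in> K \<Longrightarrow> X k \<noteq> {}"
  then have "\<forall>k\<in>K. \<exists>x. x \<in> X k" by blast
  then obtain f where f: "\<forall>k\<in>K. f k \<in> X k" by metis
  then have "sum f K \<in> family_sum K X" unfolding family_sum_def by auto
  then show ?thesis by blast
qed

lemma rcard_family_sum_empty: "rcard (family_sum {} X) = 1"
proof -
  have "rcard (family_sum {} X) \<le> 1" using rcard_le_1_iff[OF periodic_family_sum, of "{}" X] by (simp add: family_sum_empty)
  moreover have "0 < rcard (family_sum {} X)" by (rule rcard_pos[of _ 0]) (auto simp: family_sum_empty periodic_family_sum[of "{}", unfolded family_sum_empty])
  ultimately show ?thesis by simp
qed

lemma cauchy_davenport_family_sum:
  assumes "finite K" "\<And>k. k \<in> K \<Longrightarrow> periodic (X k) \<and> X k \<noteq> {}" "family_sum K X \<noteq> UNIV"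
  shows "(\<Sum>k\<in>K. rcard (X k)) + 1 \<le> rcard (family_sum K X) + card K"
  using assms
proof (induction K rule: finite_induct)
  case empty
  then show ?case by (simp add: rcard_family_sum_empty)
next
  case (insert k K)
  have ne: "family_sum K X \<noteq> {}" using insert.prems by (intro family_sum_nonempty) auto
  have eq: "family_sum (insert k K) X = X k + family_sum K X" using insert.hyps by (rule family_sum_insert)
  have "family_sum K X \<noteq> UNIV" using UNIV_plus[of "X k"] insert.prems eq by (auto simp: add.commute)
  then have "(\<Sum>k\<in>K. rcard (X k)) + 1 \<le> rcard (family_sum K X) + card K" using insert by auto
  moreover have "rcard (X k) + rcard (family_sum K X) \<le> rcard (X k + family_sum K X) + 1"
    using cauchy_davenport[OF _ periodic_family_sum _ ne, of "X k"] insert.prems eq by auto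
  ultimately show ?case using insert.hyps eq by simp
qed

lemma arcs_family_sum:
  assumes "finite K" "\<And>k. k \<in> K \<Longrightarrow> periodic (X k) \<and> X k \<noteq> {} \<and> arc d (X k)" "\<not> p dvd d"
  shows "arc d (family_sum K X) \<and> rcard (family_sum K X) + card K \<le> (\<Sum>k\<in>K. rcard (X k)) + 1"
  using assms(1,2)
proof (induction K rule: finite_induct)
  case empty
  have "rcard {x \<in> family_sum {} X. x + d \<notin> family_sum {} X} \<le> rcard (family_sum {} X)" by (rule rcard_mono) blast
  then show ?case by (simp add: rcard_family_sum_empty arc_def)
next
  case (insert k K)
  have ne: "family_sum K X \<noteq> {}" using insert.prems by (intro family_sum_nonempty) auto
  have eq: "family_sum (insert k K) X = X k + family_sum K X" using insert.hyps by (rule family_sum_insert)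
  have IH: "arc d (family_sum K X)" "rcard (family_sum K X) + card K \<le> (\<Sum>k\<in>K. rcard (X k)) + 1" using insert by auto
  have "arc d (X k + family_sum K X)" using arc_plus[OF _ periodic_family_sum _ IH(1)] insert.prems by blast
  moreover have "rcard (X k + family_sum K X) + 1 \<le> rcard (X k) + rcard (family_sum K X)"
    using rcard_plus_arcs[OF _ _ _ periodic_family_sum IH(1) ne assms(3)] insert.prems by blast
  ultimately show ?case using insert.hyps eq IH(2) by simp
qed

text \<open>Cauchy-Davenport, applied to the remaining sets and then to their sum with
  \<open>X i + X j\<close>, leaves no slack for the pair. Each remaining set has two classes and so
  enlarges the sum by at least one, which gives the third bound.\<close>

lemma tight_pair:
  assumes "tight K X" "i \<in> K" "j \<in> K" "i \<noteq> j"
  shows "rcard (X i + X j) + 1 \<le> rcard (X i) + rcard (X j)" "X i + X j \<noteq> UNIV"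
    "rcard (X i + X j) + (card K - 2) \<le> rcard (family_sum K X)"
proof -
  have K: "finite K" "\<And>k. k \<in> K \<Longrightarrow> periodic (X k)" "\<And>k. k \<in> K \<Longrightarrow> 2 \<le> rcard (X k)" "family_sum K X \<noteq> UNIV"
    "rcard (family_sum K X) + card K \<le> (\<Sum>k\<in>K. rcard (X k)) + 1"
    using assms(1) unfolding tight_def by auto
  have ne: "X k \<noteq> {}" if "k \<in> K" for k using K(3)[OF that] rcard_empty by auto
  let ?R = "K - {i, j}"
  have KR: "K = insert i (insert j ?R)" using assms by blast
  have finR: "finite ?R" using K(1) by simp
  have eq: "family_sum K X = (X i + X j) + family_sum ?R X"
    by (subst KR) (use finR assms(4) in \<open>simp add: family_sum_insert add.assoc\<close>)
  have neij: "X i + X j \<noteq> {}" using ne[OF assms(2)] ne[OF assms(3)] by (auto simp: set_plus_def)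
  have neR: "family_sum ?R X \<noteq> {}" using ne by (intro family_sum_nonempty) auto
  have R: "family_sum ?R X \<noteq> UNIV" using UNIV_plus[OF neij] K(4) eq by (auto simp: add.commute)
  show U: "X i + X j \<noteq> UNIV" using UNIV_plus[OF neR] K(4) eq by auto
  have cdR: "(\<Sum>k\<in>?R. rcard (X k)) + 1 \<le> rcard (family_sum ?R X) + card ?R"
    by (rule cauchy_davenport_family_sum[OF finR _ R]) (use K(2) ne in auto)
  have cd: "rcard (X i + X j) + rcard (family_sum ?R X) \<le> rcard (family_sum K X) + 1"
    using cauchy_davenport[OF periodic_plus[OF K(2)[OF assms(2)]] periodic_family_sum neij neR] K(4) eq by auto
  have card: "card K = card ?R + 2" by (subst KR) (use finR assms(4) in simp)
  have sum: "(\<Sum>k\<in>K. rcard (X k)) = rcard (X i) + rcard (X j) + (\<Sum>k\<in>?R. rcard (X k))"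
    by (subst KR) (use finR assms(4) in simp)
  show "rcard (X i + X j) + 1 \<le> rcard (X i) + rcard (X j)" using cdR cd card sum K(5) by simp
  have "(\<Sum>k\<in>?R. 2) \<le> (\<Sum>k\<in>?R. rcard (X k))" using K(3) by (intro sum_mono) auto
  then show "rcard (X i + X j) + (card K - 2) \<le> rcard (family_sum K X)" using cdR cd card by simp
qed

lemma tight_transfer:
  assumes "tight K X" "i \<in> K" "j \<in> K" "arc d (X i)"
  shows "arc d (X j)"
proof (cases "i = j")
  case False
  have "X j \<noteq> {}" using assms rcard_empty unfolding tight_def by fastforce
  then show ?thesis
    using arc_transfer[of "X i" "X j" d] tight_pair[OF assms(1-3) False] assms unfolding tight_def by blast
qed (use assms in simp)

text \<open>One class is missing from the whole sum, and by \<open>tight_pair\<close> every set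
  beyond \<open>i\<close> and \<open>j\<close> yields one more outside \<open>X i + X j\<close>;
  with only two sets the second missing class is assumed. Vosper's theorem for one pair is enough,
  as a single arc passes its difference on to all sets.\<close>

lemma tight_vosper:
  assumes "tight K X" "2 \<le> card K" "card K = 2 \<Longrightarrow> rcard (family_sum K X) + 2 \<le> nat p"
  shows "\<exists>d. \<not> p dvd d \<and> (\<forall>k\<in>K. arc d (X k))"
proof -
  obtain i j where ij: "i \<in> K" "j \<in> K" "i \<noteq> j"
    using assms(2) by (metis card_le_Suc0_iff_eq card.infinite not_less_eq_eq numeral_2_eq_2 zero_le)
  have "rcard (family_sum K X) < nat p" using assms(1) rcard_less_p[OF periodic_family_sum] unfolding tight_def by blast
  then have "rcard (X i + X j) + 2 \<le> nat p"
    using assms(2,3) tight_pair(3)[OF assms(1) ij] by (cases "card K = 2") auto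
  then obtain d where "\<not> p dvd d" "arc d (X i)"
    using vosper[of "X i" "X j"] tight_pair(1)[OF assms(1) ij] ij assms(1) unfolding tight_def by blast
  then show ?thesis using tight_transfer[OF assms(1) ij(1)] by blast
qed

section \<open>Critical families\<close>

definition lift :: "int set \<Rightarrow> int set" where
  "lift B = {x. x mod p \<in> B}"

definition transversal_sums :: "nat \<Rightarrow> 'i set \<Rightarrow> ('i \<Rightarrow> int set) \<Rightarrow> int set" where
  "transversal_sums l J A = {(\<Sum>i\<in>I. f i) mod p | I f. I \<subseteq> J \<and> card I = l \<and> (\<forall>i\<in>I. f i \<in> A i)}"

text \<open>The equality of the theorem, weakened to an inequality so that it survives a change of
  the family that loses sums. The bound \<open>l \<le> card J\<close> is not strict because merging
  two members lowers \<open>card J\<close> by one.\<close>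

definition critical :: "nat \<Rightarrow> 'i set \<Rightarrow> ('i \<Rightarrow> int set) \<Rightarrow> bool" where
  "critical l J A \<longleftrightarrow> finite J \<and> l \<le> card J \<and> (\<forall>j\<in>J. A j \<subseteq> {0..<p} \<and> 2 \<le> card (A j)) \<and>
     card (transversal_sums l J A) < nat p \<and>
     card (transversal_sums l J A) + l \<le> (\<Sum>a\<in>(\<Union>j\<in>J. A j). min l (occurrences J A a)) + 1"

lemma periodic_lift [intro]: "periodic (lift B)"
  unfolding periodic_def lift_def by simp

lemma lift_Int_range: "B \<subseteq> {0..<p} \<Longrightarrow> lift B \<inter> {0..<p} = B"
  unfolding lift_def by auto

lemma rcard_lift: "B \<subseteq> {0..<p} \<Longrightarrow> rcard (lift B) = card B"
  unfolding rcard_def by (simp add: lift_Int_range)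

lemma lift_Un: "lift (B \<union> C) = lift B \<union> lift C"
  unfolding lift_def by auto

lemma lift_ap:
  assumes "ap_diff p d B"
  shows "arc d (lift B)"
proof -
  obtain a k where B: "B = {(a + int i * d) mod p | i. i < k}" using assms unfolding ap_diff_def by blast
  have "lift B = progression a d k"
  proof (intro set_eqI)
    fix x
    have "x mod p = (a + int i * d) mod p \<longleftrightarrow> p dvd x - (a + int i * d)" for i
      by (rule mod_eq_dvd_iff)
    then show "x \<in> lift B \<longleftrightarrow> x \<in> progression a d k" unfolding lift_def progression_def B by blast
  qed
  then show ?thesis using arc_progression by simp
qed

lemma arc_lift_ap:
  assumes "arc d (lift B)" "B \<subseteq> {0..<p}" "B \<noteq> {}" "\<not> p dvd d"
  shows "ap_diff p d B"
proof -
  have "lift B \<noteq> {}" using lift_Int_range[OF assms(2)] assms(3) by auto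
  then obtain a where a: "lift B = progression a d (rcard (lift B))"
    using arc_is_progression[OF periodic_lift assms(1) _ assms(4)] by blast
  define k where "k = rcard (lift B)"
  have "B = progression a d k \<inter> {0..<p}" using lift_Int_range[OF assms(2)] a unfolding k_def by simp
  then have "B = {(a + int i * d) mod p | i. i < k}" unfolding progression_Int_range by auto
  then show ?thesis unfolding ap_diff_def by blast
qed

lemma family_sum_reindex:
  assumes "bij_betw h L K"
  shows "family_sum L (\<lambda>j. X (h j)) = family_sum K X"
proof (intro set_eqI iffI)
  fix x assume "x \<in> family_sum L (\<lambda>j. X (h j))"
  then obtain f where f: "\<forall>j\<in>L. f j \<in> X (h j)" "p dvd x - sum f L" unfolding family_sum_def by blast
  let ?g = "\<lambda>k. f (inv_into L h k)"
  have inv: "inv_into L h (h j) = j" if "j \<in> L" for j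
    using that assms by (simp add: bij_betw_inv_into_left)
  have "sum ?g K = (\<Sum>j\<in>L. ?g (h j))" by (rule sum.reindex_bij_betw[OF assms, symmetric])
  also have "\<dots> = sum f L" using inv by (intro sum.cong) auto
  finally have "p dvd x - sum ?g K" using f(2) by simp
  moreover have "\<forall>k\<in>K. ?g k \<in> X k"
  proof
    fix k assume "k \<in> K"
    then obtain j where "j \<in> L" "k = h j" using assms unfolding bij_betw_def by blast
    then show "?g k \<in> X k" using inv f(1) by simp
  qed
  ultimately show "x \<in> family_sum K X" unfolding family_sum_def
    by (intro CollectI exI[of _ ?g] conjI)
next
  fix x assume "x \<in> family_sum K X"
  then obtain f where f: "\<forall>k\<in>K. f k \<in> X k" "p dvd x - sum f K" unfolding family_sum_def by blast
  have "(\<Sum>j\<in>L. f (h j)) = sum f K" by (rule sum.reindex_bij_betw[OF assms])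
  moreover have "\<forall>j\<in>L. f (h j) \<in> X (h j)" using f(1) assms unfolding bij_betw_def by blast
  ultimately show "x \<in> family_sum L (\<lambda>j. X (h j))" unfolding family_sum_def using f(2)
    by (auto intro!: exI[of _ "\<lambda>j. f (h j)"])
qed

lemma family_sum_lift_Int_range:
  assumes "\<And>k. k \<in> K \<Longrightarrow> B k \<subseteq> {0..<p}"
  shows "family_sum K (\<lambda>k. lift (B k)) \<inter> {0..<p} = {(\<Sum>k\<in>K. f k) mod p | f. \<forall>k\<in>K. f k \<in> B k}"
proof (intro set_eqI iffI)
  fix x assume x: "x \<in> family_sum K (\<lambda>k. lift (B k)) \<inter> {0..<p}"
  then obtain f where f: "\<forall>k\<in>K. f k \<in> lift (B k)" "p dvd x - sum f K" unfolding family_sum_def by blast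
  have "x mod p = sum f K mod p" using f(2) by (simp only: mod_eq_dvd_iff)
  then have "x = (\<Sum>k\<in>K. f k mod p) mod p" using x by (simp add: mod_sum_eq)
  then show "x \<in> {(\<Sum>k\<in>K. f k) mod p | f. \<forall>k\<in>K. f k \<in> B k}"
    using f(1) unfolding lift_def by (auto intro!: exI[of _ "\<lambda>k. f k mod p"])
next
  fix x assume "x \<in> {(\<Sum>k\<in>K. f k) mod p | f. \<forall>k\<in>K. f k \<in> B k}"
  then obtain f where f: "x = sum f K mod p" "\<forall>k\<in>K. f k \<in> B k" by blast
  have "x mod p = sum f K mod p" using f(1) by simp
  then have "p dvd x - sum f K" by (simp only: mod_eq_dvd_iff)
  moreover have "\<forall>k\<in>K. f k \<in> lift (B k)"
  proof
    fix k assume "k \<in> K"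
    then have "f k \<in> B k" "f k \<in> {0..<p}" using assms f(2) by blast+
    then show "f k \<in> lift (B k)" unfolding lift_def by simp
  qed
  ultimately show "x \<in> family_sum K (\<lambda>k. lift (B k)) \<inter> {0..<p}"
    using f(1) p_pos unfolding family_sum_def by auto
qed

lemma transversal_sums_range: "transversal_sums l J A \<subseteq> {0..<p}"
  unfolding transversal_sums_def using p_pos by auto

lemma finite_transversal_sums: "finite (transversal_sums l J A)"
  by (rule finite_subset[OF transversal_sums_range]) simp

lemma transversal_sums_refines:
  assumes "refines K B J A"
  shows "transversal_sums l K B \<subseteq> transversal_sums l J A"
proof
  fix x assume "x \<in> transversal_sums l K B"
  then obtain I f where I: "x = sum f I mod p" "I \<subseteq> K" "card I = l" "\<forall>i\<in>I. f i \<in> B i"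
    unfolding transversal_sums_def by blast
  obtain \<sigma> where s: "inj_on \<sigma> I" "\<sigma> ` I \<subseteq> J" "\<And>k. k \<in> I \<Longrightarrow> f k \<in> A (\<sigma> k)"
    using refinesE[OF assms I(2), of f] I(4) by blast
  let ?g = "\<lambda>k. f (inv_into I \<sigma> k)"
  have "sum ?g (\<sigma> ` I) = sum f I" using s(1) by (simp add: sum.reindex)
  moreover have "card (\<sigma> ` I) = l" using s(1) I(3) by (simp add: card_image)
  moreover have "\<forall>k\<in>\<sigma> ` I. ?g k \<in> A k" using s(1,3) by auto
  ultimately show "x \<in> transversal_sums l J A" unfolding transversal_sums_def using I(1) s(2)
    by (intro CollectI exI[of _ "\<sigma> ` I"] exI[of _ ?g]) simp
qed

text \<open>The sizes of the \<open>B k\<close> add up to the sum of the capped multiplicities. So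
  Cauchy-Davenport bounds the sum of the \<open>B k\<close> from below by the very number that
  \<open>critical\<close> imposes from above on the larger set of all sums of \<open>A\<close>.
  Every inequality is then an equality, and the two sets of sums coincide.\<close>

lemma realizes_tight:
  assumes "critical l J A" "realizes l K B J A"
  shows "tight K (\<lambda>k. lift (B k))" "family_sum K (\<lambda>k. lift (B k)) \<inter> {0..<p} = transversal_sums l J A"
    "\<And>k. k \<in> K \<Longrightarrow> B k \<subseteq> {0..<p}" "card (transversal_sums l J A) + l = (\<Sum>a\<in>(\<Union>j\<in>J. A j). min l (occurrences J A a)) + 1"
proof -
  let ?U = "\<Union>j\<in>J. A j" and ?S = "family_sum K (\<lambda>k. lift (B k))"
  have C: "finite J" "\<And>j. j \<in> J \<Longrightarrow> A j \<subseteq> {0..<p}" "card (transversal_sums l J A) < nat p"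
    "card (transversal_sums l J A) + l \<le> (\<Sum>a\<in>?U. min l (occurrences J A a)) + 1"
    using assms(1) unfolding critical_def by auto
  have R: "K \<subseteq> J" "card K = l" "\<And>k. k \<in> K \<Longrightarrow> 2 \<le> card (B k)" "refines K B J A"
    "\<And>a. occurrences K B a = min l (occurrences J A a)"
    using assms(2) unfolding realizes_def by auto
  have finK: "finite K" using R(1) C(1) finite_subset by blast
  have U: "?U \<subseteq> {0..<p}" "finite ?U" using C(2) finite_subset[of ?U "{0..<p}"] by blast+
  have BU: "\<And>k. k \<in> K \<Longrightarrow> B k \<subseteq> ?U" using realizes_subset[OF assms(2) C(1)] by blast
  then show B: "\<And>k. k \<in> K \<Longrightarrow> B k \<subseteq> {0..<p}" using U(1) by blast
  have "(\<Sum>a\<in>?U. min l (occurrences J A a)) = (\<Sum>k\<in>K. card (B k))"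
    using sum_occurrences[OF U(2) finK, of B] BU R(5) by simp
  then have sum: "(\<Sum>a\<in>?U. min l (occurrences J A a)) = (\<Sum>k\<in>K. rcard (lift (B k)))"
    using rcard_lift[OF B] by simp
  have "{(\<Sum>k\<in>K. f k) mod p | f. \<forall>k\<in>K. f k \<in> B k} \<subseteq> transversal_sums l K B"
    unfolding transversal_sums_def using R(2) by blast
  then have sub: "?S \<inter> {0..<p} \<subseteq> transversal_sums l J A"
    using family_sum_lift_Int_range[of K B, OF B] transversal_sums_refines[OF R(4), of l] by simp
  have fin: "finite (transversal_sums l J A)" by (rule finite_transversal_sums)
  have le: "rcard ?S \<le> card (transversal_sums l J A)" unfolding rcard_def by (rule card_mono[OF fin sub])
  have neU: "?S \<noteq> UNIV" using le C(3) rcard_UNIV by auto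
  have ge: "2 \<le> rcard (lift (B k))" if "k \<in> K" for k using R(3) rcard_lift[OF B] that by simp
  have ne: "lift (B k) \<noteq> {}" if "k \<in> K" for k using ge[OF that] rcard_empty by auto
  have cd: "(\<Sum>k\<in>K. rcard (lift (B k))) + 1 \<le> rcard ?S + card K"
    by (rule cauchy_davenport_family_sum[OF finK _ neU]) (use ne in blast)
  show "card (transversal_sums l J A) + l = (\<Sum>a\<in>?U. min l (occurrences J A a)) + 1"
    using cd le C(4) sum R(2) by simp
  show "?S \<inter> {0..<p} = transversal_sums l J A"
    using sub by (rule card_seteq[OF fin]) (use cd C(4) sum R(2) in \<open>simp add: rcard_def\<close>)
  show "tight K (\<lambda>k. lift (B k))"
    unfolding tight_def using finK ge neU le C(4) sum R(2) periodic_lift by simp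
qed

lemma critical_vosper:
  assumes "critical l J A" "realizes l K B J A" "2 \<le> l" "l = 2 \<Longrightarrow> card (transversal_sums l J A) < nat p - 1"
  shows "\<exists>d. \<not> p dvd d \<and> (\<forall>k\<in>K. arc d (lift (B k)))"
proof -
  note t = realizes_tight[OF assms(1,2)]
  have "card K = l" using assms(2) unfolding realizes_def by blast
  moreover have "rcard (family_sum K (\<lambda>k. lift (B k))) = card (transversal_sums l J A)" unfolding rcard_def t(2) by simp
  ultimately show ?thesis using assms(3,4) by (intro tight_vosper[OF t(1)]) auto
qed

lemma saturated_subset:
  "{a. Suc l \<le> occurrences J A a} \<subseteq> (\<Union>j\<in>J. A j)"
  using occurrences_posD[of J A] by fastforce

lemma critical_finite:
  assumes "critical l J A" "i \<in> J" "J' \<subseteq> J"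
  shows "finite (A i \<union> {a. Suc n \<le> occurrences J' A a})"
proof -
  have "A i \<union> {a. Suc n \<le> occurrences J' A a} \<subseteq> {0..<p}"
    using assms saturated_subset[of n J' A] unfolding critical_def by blast
  then show ?thesis using finite_subset by blast
qed

lemma realizes_through:
  assumes "critical (Suc l) J A" "i \<in> J"
  shows "\<exists>K B. realizes (Suc l) K B J A \<and> i \<in> K \<and> B i = A i \<union> {a. Suc l \<le> occurrences J A a}"
proof -
  have C: "finite J" "Suc l \<le> card J" "\<And>j. j \<in> J \<Longrightarrow> 2 \<le> card (A j)"
    using assms(1) unfolding critical_def by auto
  obtain K B where "realizes l K B (J - {i}) A"
    using realizes_ex[of "J - {i}" l A] C assms(2) by fastforce
  from realizes_insert[OF C(1) assms(2) C(3)[OF assms(2)] critical_finite[OF assms subset_refl] this]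
  show ?thesis by (meson fun_upd_same insertI1)
qed

text \<open>The set at \<open>i\<close> is inserted last and is therefore the one saturated with
  respect to all of \<open>J\<close>; the set inserted at \<open>j\<close> is saturated only within
  \<open>J - {i}\<close>. Exchanging the roles gives a second family, which still contains
  \<open>B k\<close>.\<close>

lemma realizes_insert2:
  assumes "critical (Suc (Suc l)) J A" "i \<in> J" "j \<in> J" "i \<noteq> j"
    and R: "realizes l K B (J - {i, j}) A" and k: "k \<in> K"
  shows "\<exists>L C. realizes (Suc (Suc l)) L C J A \<and> i \<in> L \<and> k \<in> L
    \<and> C i = A i \<union> {a. Suc (Suc l) \<le> occurrences J A a} \<and> C k = B k"
proof -
  have C: "finite J" "\<And>j. j \<in> J \<Longrightarrow> 2 \<le> card (A j)"
    using assms(1) unfolding critical_def by auto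
  have kij: "k \<noteq> i" "k \<noteq> j" using R k unfolding realizes_def by auto
  have "realizes l K B (J - {i} - {j}) A" using R by (simp add: Diff_insert2[symmetric] insert_commute)
  then have "realizes (Suc l) (insert j K) (B(j := A j \<union> {a. Suc l \<le> occurrences (J - {i}) A a})) (J - {i}) A"
    using assms(3,4) C critical_finite[OF assms(1,3), of "J - {i}" l]
    by (intro realizes_insert) auto
  from realizes_insert[OF C(1) assms(2) C(2)[OF assms(2)] critical_finite[OF assms(1,2) subset_refl] this]
  show ?thesis using k kij by (intro exI conjI) (assumption | simp)+
qed

section \<open>One common difference for the members and for their union\<close>

lemma critical_common_difference:
  assumes "critical l J A" "3 \<le> l" "i \<in> J" "j \<in> J"
    and arc: "arc d (lift (A i \<union> {a. l \<le> occurrences J A a}))"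
  shows "arc d (lift (A j \<union> {a. l \<le> occurrences J A a}))"
proof (cases "i = j")
  case False
  obtain n where n: "l = Suc (Suc n)" "0 < n"
    using assms(2) by (metis Suc_le_D numeral_3_eq_3 Suc_le_mono zero_less_Suc)
  have C: "finite J" "l \<le> card J" "\<And>j. j \<in> J \<Longrightarrow> 2 \<le> card (A j)"
    using assms(1) unfolding critical_def by auto
  have "n \<le> card (J - {i, j})" using C(1,2) n(1) assms(3,4) False by simp
  then obtain K B where KB: "realizes n K B (J - {i, j}) A"
    using realizes_ex[of "J - {i, j}" n A] C by auto
  \<comment> \<open>Here \<open>3 \<le> l\<close> enters: the family for the other indices has
    \<open>l - 2 > 0\<close> sets, so the two extensions have a set in common.\<close>
  then have "K \<noteq> {}" using n(2) unfolding realizes_def by auto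
  then obtain k where k: "k \<in> K" by blast
  have KB': "realizes n K B (J - {j, i}) A" using KB by (simp add: insert_commute)
  obtain L1 C1 where 1: "realizes l L1 C1 J A" "i \<in> L1" "k \<in> L1"
    "C1 i = A i \<union> {a. l \<le> occurrences J A a}" "C1 k = B k"
    using realizes_insert2[OF assms(1)[unfolded n(1)] assms(3,4) False KB k] n(1) by blast
  obtain L2 C2 where 2: "realizes l L2 C2 J A" "j \<in> L2" "k \<in> L2"
    "C2 j = A j \<union> {a. l \<le> occurrences J A a}" "C2 k = B k"
    using realizes_insert2[OF assms(1)[unfolded n(1)] assms(4,3) _ KB' k] n(1) False by blast
  have "arc d (lift (C1 k))"
    using tight_transfer[OF realizes_tight(1)[OF assms(1) 1(1)] 1(2,3)] arc 1(4) by simp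
  then have "arc d (lift (C2 j))"
    using tight_transfer[OF realizes_tight(1)[OF assms(1) 2(1)] 2(3,2)] 1(5) 2(5) by simp
  then show ?thesis using 2(4) by simp
qed (use arc in simp)

text \<open>For disjoint sets, uncrossing leaves the empty set at \<open>j\<close>. That index can
  be removed without changing any multiplicity, while the set of sums can only shrink.\<close>

lemma critical_merge:
  assumes "critical l J A" "l < card J" "i \<in> J" "j \<in> J" "i \<noteq> j" "A i \<inter> A j = {}"
  shows "critical l (J - {j}) (uncross i j A)" "occurrences (J - {j}) (uncross i j A) a = occurrences J A a"
proof -
  let ?A = "uncross i j A"
  have C: "finite J" "\<And>j. j \<in> J \<Longrightarrow> A j \<subseteq> {0..<p} \<and> 2 \<le> card (A j)"
    "card (transversal_sums l J A) < nat p" "card (transversal_sums l J A) + l \<le> (\<Sum>a\<in>(\<Union>j\<in>J. A j). min l (occurrences J A a)) + 1"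
    using assms(1) unfolding critical_def by auto
  have Aj: "?A j = {}" using assms(6) unfolding uncross_def by simp
  show m: "occurrences (J - {j}) ?A a = occurrences J A a" for a
    using occurrences_remove[OF C(1) assms(4), of ?A a] occurrences_uncross[OF C(1) assms(3-5), of A a] Aj by simp
  have U: "(\<Union>k\<in>J - {j}. ?A k) = (\<Union>k\<in>J. A k)"
  proof -
    have "(\<Union>k\<in>J - {j}. ?A k) = ?A i \<union> (\<Union>k\<in>J - {i, j}. ?A k)" using assms(3,5) by blast
    also have "(\<Union>k\<in>J - {i, j}. ?A k) = (\<Union>k\<in>J - {i, j}. A k)"
      by (intro SUP_cong) (auto simp: uncross_def)
    also have "?A i = A i \<union> A j" using assms(5) unfolding uncross_def by simp
    also have "A i \<union> A j \<union> (\<Union>k\<in>J - {i, j}. A k) = (\<Union>k\<in>J. A k)" using assms(3,4) by blast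
    finally show ?thesis .
  qed
  have "refines (J - {j}) ?A J A"
    by (rule refines_trans[OF refines_subset refines_uncross[OF assms(3-5)]]) auto
  then have "transversal_sums l (J - {j}) ?A \<subseteq> transversal_sums l J A" by (rule transversal_sums_refines)
  then have le: "card (transversal_sums l (J - {j}) ?A) \<le> card (transversal_sums l J A)"
    by (rule card_mono[OF finite_transversal_sums])
  have "?A k \<subseteq> {0..<p} \<and> 2 \<le> card (?A k)" if k: "k \<in> J - {j}" for k
  proof (cases "k = i")
    case True
    have "A i \<union> A j \<subseteq> {0..<p}" using C(2) assms(3,4) by blast
    moreover from this have "card (A i) \<le> card (A i \<union> A j)"
      by (intro card_mono) (auto dest: finite_subset)
    ultimately show ?thesis using C(2)[OF assms(3)] True assms(5) unfolding uncross_def by simp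
  qed (use k C(2) in \<open>simp add: uncross_def\<close>)
  then show "critical l (J - {j}) ?A"
    unfolding critical_def U m using C le assms(2,4) by auto
qed

lemma critical_union_arc:
  assumes "critical l J A" "3 \<le> l" "l < card J" "\<not> p dvd d"
    and arc: "\<And>i. i \<in> J \<Longrightarrow> arc d (lift (A i \<union> {a. l \<le> occurrences J A a}))"
  shows "arc d (lift (\<Union>j\<in>J. A j))"
proof -
  let ?M = "{a. l \<le> occurrences J A a}"
  define X where "X i = lift (A i \<union> ?M)" for i
  have C: "finite J" "\<And>j. j \<in> J \<Longrightarrow> A j \<subseteq> {0..<p} \<and> 2 \<le> card (A j)"
    using assms(1) unfolding critical_def by auto
  obtain n where n: "l = Suc n" using assms(2) by (cases l) auto
  have M: "?M \<subseteq> (\<Union>j\<in>J. A j)" using saturated_subset[of n J A] n by simp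
  have range: "A i \<union> ?M \<subseteq> {0..<p}" if "i \<in> J" for i using M C(2) that by blast
  have arcX: "arc d (X i)" if "i \<in> J" for i using arc[OF that] unfolding X_def .
  have perX: "periodic (X i)" for i unfolding X_def by (rule periodic_lift)
  have pair: "arc d (X i \<union> X j)" if ij: "i \<in> J" "j \<in> J" for i j
  proof (cases "X i \<inter> X j = {}")
    case False
    then show ?thesis using arc_Un[OF perX arcX perX arcX assms(4)] ij by blast
  next
    case True
    have "(A i \<union> ?M) \<inter> (A j \<union> ?M) = {}"
      using True lift_Int_range[OF range[OF ij(1)]] lift_Int_range[OF range[OF ij(2)]]
      unfolding X_def by blast
    then have M0: "?M = {}" and disj: "A i \<inter> A j = {}" by blast+
    have "A i \<noteq> {}" using C(2)[OF ij(1)] by auto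
    then have ne: "i \<noteq> j" using disj by auto
    let ?A = "uncross i j A"
    note crit = critical_merge[OF assms(1,3) ij ne disj]
    \<comment> \<open>A third member is unaffected by the merging, keeps its arc with difference
      \<open>d\<close>, and passes this difference on to the merged set.\<close>
    have "card (J - {i, j}) \<noteq> 0" using assms(2,3) C(1) ij ne by simp
    then obtain k where k: "k \<in> J" "k \<noteq> i" "k \<noteq> j" by (metis Diff_iff card.empty ex_in_conv insertCI)
    have "arc d (lift (?A k \<union> {a. l \<le> occurrences (J - {j}) ?A a}))"
      using arc[OF k(1)] k crit(2) by (simp add: uncross_def)
    then have "arc d (lift (?A i \<union> {a. l \<le> occurrences (J - {j}) ?A a}))"
      using critical_common_difference[OF crit(1) assms(2), of k i d] k ij ne by simp
    then have "arc d (lift (A i \<union> A j))" using crit(2) M0 ne by (simp add: uncross_def)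
    then show ?thesis unfolding X_def M0 by (simp add: lift_Un)
  qed
  have "J \<noteq> {}" using assms(3) by auto
  then obtain i where i: "i \<in> J" by blast
  \<comment> \<open>The union is built around one fixed \<open>X i\<close>: the sets themselves may
    be disjoint, but all \<open>X i \<union> X k\<close> contain \<open>X i\<close>, so each step
    joins intersecting arcs.\<close>
  have "arc d (X i \<union> (\<Union>j\<in>F. X j)) \<and> periodic (X i \<union> (\<Union>j\<in>F. X j))" if "finite F" "F \<subseteq> J" for F
    using that
  proof (induction F rule: finite_induct)
    case empty
    then show ?case using arcX[OF i] perX by simp
  next
    case (insert k F)
    let ?Y = "X i \<union> (\<Union>j\<in>F. X j)"
    have Y: "arc d ?Y" "periodic ?Y" using insert by auto
    have "2 \<le> card (A i)" using C(2) i by blast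
    then have "X i \<noteq> {}" using lift_Int_range[OF range[OF i]] unfolding X_def by auto
    then have int: "?Y \<inter> (X i \<union> X k) \<noteq> {}" by blast
    have "arc d (?Y \<union> (X i \<union> X k))"
      using arc_Un[OF Y(2,1) periodic_Un[OF perX perX] pair assms(4) int] i insert.prems by blast
    moreover have "periodic (?Y \<union> (X i \<union> X k))" using Y(2) perX by blast
    moreover have "?Y \<union> (X i \<union> X k) = X i \<union> (\<Union>j\<in>insert k F. X j)" by blast
    ultimately show ?case by simp
  qed
  from this[OF C(1) subset_refl] have "arc d (\<Union>j\<in>J. X j)" using i by (simp add: Un_absorb1 UN_upper)
  moreover have "(\<Union>j\<in>J. X j) = lift (\<Union>j\<in>J. A j)"
    using M unfolding X_def lift_def by auto
  ultimately show ?thesis by simp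
qed

section \<open>Families of arcs and minimizing sequences\<close>

lemma minimizingI:
  assumes "critical l {1..m} As" "realizes l K B {1..m} As" "\<not> p dvd d"
    and "\<And>k. k \<in> K \<Longrightarrow> arc d (lift (B k))"
  shows "minimizing p l d m As"
proof -
  note t = realizes_tight[OF assms(1,2)]
  have R: "K \<subseteq> {1..m}" "card K = l" "\<And>k. k \<in> K \<Longrightarrow> 2 \<le> card (B k)"
    "\<And>a. occurrences K B a = min l (occurrences {1..m} As a)"
    using assms(2) unfolding realizes_def by auto
  have "finite K" using R(1) finite_subset by blast
  then obtain h where h: "bij_betw h {1..l} K"
    using R(2) by (metis card_atLeastAtMost diff_Suc_1 finite_atLeastAtMost finite_same_card_bij)
  define Bs where "Bs j = B (h j)" for j
  have hK: "h j \<in> K" if "j \<in> {1..l}" for j using h that unfolding bij_betw_def by blast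
  have "Bs j \<subseteq> union_seq m As \<and> card (Bs j) \<ge> 2 \<and> ap_diff p d (Bs j)" if j: "j \<in> {1..l}" for j
  proof -
    have 2: "2 \<le> card (Bs j)" using R(3)[OF hK[OF j]] unfolding Bs_def .
    then have "Bs j \<noteq> {}" by auto
    then show ?thesis
      using 2 arc_lift_ap[OF assms(4)[OF hK[OF j]] t(3)[OF hK[OF j]] _ assms(3)]
        realizes_subset[OF assms(2) _ hK[OF j]] unfolding Bs_def union_seq_def by simp
  qed
  moreover have "mu l m As a = card {j\<in>{1..l}. a \<in> Bs j}" for a
  proof -
    have "bij_betw h {j\<in>{1..l}. a \<in> Bs j} {k\<in>K. a \<in> B k}"
      unfolding bij_betw_def
    proof
      show "inj_on h {j\<in>{1..l}. a \<in> Bs j}"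
        by (rule inj_on_subset[OF bij_betw_imp_inj_on[OF h]]) blast
      have "h ` {j\<in>{1..l}. a \<in> Bs j} = {k\<in>h ` {1..l}. a \<in> B k}" unfolding Bs_def by blast
      then show "h ` {j\<in>{1..l}. a \<in> Bs j} = {k\<in>K. a \<in> B k}" using h unfolding bij_betw_def by simp
    qed
    then show ?thesis using R(4)[of a] unfolding mu_def occurrences_def by (simp add: bij_betw_same_card)
  qed
  moreover have "sumset p l Bs = restricted_sumset p l m As"
  proof -
    have "sumset p l Bs = family_sum {1..l} (\<lambda>j. lift (Bs j)) \<inter> {0..<p}"
      unfolding sumset_def
    proof (rule family_sum_lift_Int_range[symmetric])
      fix j assume "j \<in> {1..l}"
      then show "Bs j \<subseteq> {0..<p}" unfolding Bs_def by (intro t(3) hK)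
    qed
    also have "\<dots> = family_sum K (\<lambda>k. lift (B k)) \<inter> {0..<p}"
      unfolding Bs_def using family_sum_reindex[OF h, of "\<lambda>k. lift (B k)"] by simp
    also have "\<dots> = restricted_sumset p l m As"
      unfolding t(2) restricted_sumset_def transversal_sums_def ..
    finally show ?thesis .
  qed
  moreover have "d mod p \<noteq> 0" using assms(3) by (simp add: dvd_eq_mod_eq_0)
  ultimately show ?thesis unfolding minimizing_def by (intro conjI exI[of _ Bs]) simp_all
qed

text \<open>Progressions with one difference have a sum of at most the claimed size; as it is not
  everything, Cauchy-Davenport gives the reverse inequality. The multiplicity condition turns the
  total size of the \<open>Bs\<close> into the sum of \<open>mu\<close>.\<close>

lemma minimizing_card:
  assumes "minimizing p l d m As" "card (restricted_sumset p l m As) < nat p"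
    and "\<And>j. j \<in> {1..m} \<Longrightarrow> As j \<subseteq> {0..<p}"
  shows "card (restricted_sumset p l m As) + l = (\<Sum>a\<in>union_seq m As. mu l m As a) + 1"
proof -
  obtain Bs where d: "\<not> p dvd d"
    and Bs: "\<And>j. j \<in> {1..l} \<Longrightarrow> Bs j \<subseteq> union_seq m As \<and> card (Bs j) \<ge> 2 \<and> ap_diff p d (Bs j)"
    and mu: "\<And>a. a \<in> union_seq m As \<Longrightarrow> mu l m As a = card {j\<in>{1..l}. a \<in> Bs j}"
    and sumset: "sumset p l Bs = restricted_sumset p l m As"
    using assms(1) unfolding minimizing_def dvd_eq_mod_eq_0 by blast
  let ?S = "family_sum {1..l} (\<lambda>j. lift (Bs j))"
  have U: "union_seq m As \<subseteq> {0..<p}" using assms(3) unfolding union_seq_def by blast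
  then have B: "Bs j \<subseteq> {0..<p}" if "j \<in> {1..l}" for j using Bs that by blast
  have "?S \<inter> {0..<p} = restricted_sumset p l m As"
    using family_sum_lift_Int_range[of "{1..l}" Bs] B sumset unfolding sumset_def by simp
  then have NS: "rcard ?S = card (restricted_sumset p l m As)" unfolding rcard_def by simp
  have ne: "lift (Bs j) \<noteq> {}" if "j \<in> {1..l}" for j
    using lift_Int_range[OF B[OF that]] Bs[OF that] by auto
  have "(\<Sum>j\<in>{1..l}. rcard (lift (Bs j))) + 1 \<le> rcard ?S + card {1..l}"
    by (rule cauchy_davenport_family_sum) (use ne NS assms(2) rcard_UNIV in auto)
  moreover have "rcard ?S + card {1..l} \<le> (\<Sum>j\<in>{1..l}. rcard (lift (Bs j))) + 1"
    using arcs_family_sum[of "{1..l}" "\<lambda>j. lift (Bs j)" d] ne lift_ap Bs d by auto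
  moreover have "(\<Sum>a\<in>union_seq m As. mu l m As a) = (\<Sum>j\<in>{1..l}. rcard (lift (Bs j)))"
  proof -
    have "finite (union_seq m As)" using U finite_subset by blast
    then have "(\<Sum>a\<in>union_seq m As. occurrences {1..l} Bs a) = (\<Sum>j\<in>{1..l}. card (Bs j))"
      using Bs by (intro sum_occurrences) auto
    then show ?thesis using mu rcard_lift[OF B] unfolding occurrences_def by simp
  qed
  ultimately show ?thesis using NS by simp
qed

end

theorem theorem4p2:
  fixes p :: int and l m :: nat and As :: "nat \<Rightarrow> int set"
  assumes "prime p" and "2 \<le> l" and "l < m"
    and "\<forall>i\<in>{1..m}. As i \<subseteq> {0..<p} \<and> card (As i) \<ge> 2"
    and "card (restricted_sumset p l m As) < (if l = 2 then nat p - 1 else nat p)"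
  shows "(int (card (restricted_sumset p l m As)) =
            (\<Sum>a\<in>union_seq m As. int (mu l m As a)) - int l + 1
          \<longleftrightarrow> (\<exists>d. minimizing p l d m As))
    \<and> (int (card (restricted_sumset p l m As)) =
            (\<Sum>a\<in>union_seq m As. int (mu l m As a)) - int l + 1 \<longrightarrow>
         (l = 2 \<longrightarrow> (\<forall>i\<in>{1..m}. is_ap p (As i \<union> {a\<in>union_seq m As. mu l m As a = l})))
       \<and> (l \<ge> 3 \<longrightarrow> (\<exists>d. minimizing p l d m As \<and> ap_diff p d (union_seq m As) \<and>
              (\<forall>i\<in>{1..m}. ap_diff p d (As i \<union> {a\<in>union_seq m As. mu l m As a = l})))))"
proof -
  interpret prime_modulus p by unfold_locales (rule assms(1))
  let ?S = "restricted_sumset p l m As" and ?J = "{1..m}" and ?U = "union_seq m As"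
  define M where "M = {a\<in>?U. mu l m As a = l}"
  have As: "\<And>j. j \<in> ?J \<Longrightarrow> As j \<subseteq> {0..<p}" "\<And>j. j \<in> ?J \<Longrightarrow> 2 \<le> card (As j)"
    using assms(4) by auto
  have U: "?U \<subseteq> {0..<p}" using As(1) unfolding union_seq_def by blast
  have transversal_sums: "transversal_sums l ?J As = ?S" unfolding restricted_sumset_def transversal_sums_def ..
  have small: "card ?S < nat p" "l = 2 \<Longrightarrow> card ?S < nat p - 1"
    using assms(5) by (auto split: if_splits)
  have eq_iff: "int (card ?S) = (\<Sum>a\<in>?U. int (mu l m As a)) - int l + 1
      \<longleftrightarrow> card ?S + l = (\<Sum>a\<in>?U. mu l m As a) + 1"
    by (simp flip: of_nat_sum) linarith
  have M: "M = {a. l \<le> occurrences ?J As a}"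
  proof -
    obtain n where n: "l = Suc n" using assms(2) by (cases l) auto
    have "{a. l \<le> occurrences ?J As a} \<subseteq> ?U"
      using saturated_subset[of n ?J As] unfolding n union_seq_def .
    moreover have "mu l m As a = l \<longleftrightarrow> l \<le> occurrences ?J As a" for a
      unfolding mu_def occurrences_def by auto
    ultimately show ?thesis unfolding M_def by auto
  qed
  have range: "As i \<union> M \<subseteq> {0..<p}" "As i \<union> M \<noteq> {}" if "i \<in> ?J" for i
    using As(1)[OF that] As(2)[OF that] U unfolding M_def by auto
  have main: "(\<exists>d. minimizing p l d m As) \<and> (\<forall>i\<in>?J. is_ap p (As i \<union> M))
      \<and> (l \<ge> 3 \<longrightarrow> (\<exists>d. minimizing p l d m As \<and> ap_diff p d ?U \<and> (\<forall>i\<in>?J. ap_diff p d (As i \<union> M))))"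
    if eq: "card ?S + l = (\<Sum>a\<in>?U. mu l m As a) + 1"
  proof -
    have crit: "critical l ?J As"
      using eq As small(1) assms(3) unfolding critical_def transversal_sums occurrences_def mu_def union_seq_def by simp
    have through: "\<exists>d. \<not> p dvd d \<and> minimizing p l d m As \<and> arc d (lift (As i \<union> M))" if i: "i \<in> ?J" for i
    proof -
      obtain n where n: "l = Suc n" using assms(2) by (cases l) auto
      obtain K B where KB: "realizes l K B ?J As" "i \<in> K" "B i = As i \<union> M"
        using realizes_through[OF crit[unfolded n] i] unfolding M n by blast
      obtain d where "\<not> p dvd d" "\<forall>k\<in>K. arc d (lift (B k))"
        using critical_vosper[OF crit KB(1) assms(2)] small(2) unfolding transversal_sums by blast
      then show ?thesis using minimizingI[OF crit KB(1)] KB(2,3) by metis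
    qed
    have one: "1 \<in> ?J" using assms(2,3) by simp
    \<comment> \<open>For \<open>l \<ge> 3\<close> this difference, found at index 1, is carried to
      all members and to their union, so it agrees with that of the minimizing sequence.\<close>
    obtain d where d: "\<not> p dvd d" "minimizing p l d m As" "arc d (lift (As 1 \<union> M))"
      using through[OF one] by blast
    \<comment> \<open>Each \<open>i\<close> has its own reduced family and hence its own difference,
      which is all that is claimed for \<open>l = 2\<close>.\<close>
    have "is_ap p (As i \<union> M)" if i: "i \<in> ?J" for i
      using through[OF i] arc_lift_ap[OF _ range[OF i]] unfolding is_ap_def dvd_eq_mod_eq_0 by blast
    moreover have "ap_diff p d ?U \<and> (\<forall>i\<in>?J. ap_diff p d (As i \<union> M))" if l: "3 \<le> l"
    proof -
      have arc: "arc d (lift (As i \<union> M))" if "i \<in> ?J" for i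
        using critical_common_difference[OF crit l one that] d(3) unfolding M by blast
      then have "arc d (lift ?U)"
        using critical_union_arc[OF crit l _ d(1)] assms(3) unfolding M union_seq_def by simp
      moreover have "?U \<noteq> {}" using As(2)[OF one] one unfolding union_seq_def by fastforce
      ultimately show ?thesis using arc arc_lift_ap[OF _ _ _ d(1)] U range by blast
    qed
    ultimately show ?thesis using d(2) by blast
  qed
  have "card ?S + l = (\<Sum>a\<in>?U. mu l m As a) + 1" if "minimizing p l d m As" for d
    using minimizing_card[OF that small(1) As(1)] .
  then show ?thesis unfolding eq_iff M_def[symmetric] using main by blast
qed

end
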